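(* Every outerplanar graph is $3$-defective $2$-correspondable. Furthermore, $3$ defects is best possible: there exists an outerplanar graph that is not $2$-defective $2$-correspondable.
   Context: All graphs are finite, simple and undirected. A graph is outerplanar if it can be embedded in the plane with all vertices on the boundary of the outer face. A correspondence cover of a graph $G$ is a pair $\mathcal{H}=(L,H)$ where $H$ is a graph and $L: V(G)\to 2^{V(H)}$ satisfies: (1) $\{L(v): v\in V(G)\}$ partitions $V(H)$; (2) each $L(v)$ is an independent set in $H$; (3) for all $u,v\in V(G)$, the edges of $H[L(u)\cup L(v)]$ form a matching, which is empty if $uv\notin E(G)$. The cover is $k$-fold if $|L(v)|\ge k$ for all $v$. Two colors conflict if they are adjacent in $H$. An $\mathcal{H}$-coloring is a map $\phi:V(G)\to V(H)$ with $\phi(v)\in L(v)$ for all $v$; it is $d$-defective if the subgraph of $H$ induced by the image of $\phi$ has maximum degree at most $d$. A graph is $d$-defective $k$-correspondable if it has a $d$-defective $\mathcal{H}$-coloring for every $k$-fold correspondence cover $\mathcal{H}$. *)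

theory Defs
  imports "HOL-Analysis.Analysis"
begin

section \<open>Finite simple undirected graphs\<close>

type_synonym 'a ugraph = "'a set \<times> 'a set set"

abbreviation verts :: "'a ugraph \<Rightarrow> 'a set" where
  "verts G \<equiv> fst G"

abbreviation edges :: "'a ugraph \<Rightarrow> 'a set set" where
  "edges G \<equiv> snd G"

definition simple_graph :: "'a ugraph \<Rightarrow> bool" where
  "simple_graph G \<longleftrightarrow> finite (verts G) \<and> (\<forall>e\<in>edges G. e \<subseteq> verts G \<and> card e = 2)"

definition induced_subgraph :: "'a ugraph \<Rightarrow> 'a set \<Rightarrow> 'a ugraph" where
  "induced_subgraph G S = (verts G \<inter> S, {e \<in> edges G. e \<subseteq> S})"

definition independent_set :: "'a ugraph \<Rightarrow> 'a set \<Rightarrow> bool" where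
  "independent_set G S \<longleftrightarrow> S \<subseteq> verts G \<and> edges (induced_subgraph G S) = {}"

definition vertex_degree :: "'a ugraph \<Rightarrow> 'a \<Rightarrow> nat" where
  "vertex_degree G v = card {e \<in> edges G. v \<in> e}"

text \<open>Stated as a bound, so that the empty graph needs no convention.\<close>
definition max_degree_at_most :: "'a ugraph \<Rightarrow> nat \<Rightarrow> bool" where
  "max_degree_at_most G d \<longleftrightarrow> (\<forall>v\<in>verts G. vertex_degree G v \<le> d)"

definition matching :: "'a set set \<Rightarrow> bool" where
  "matching M \<longleftrightarrow> pairwise disjnt M"

section \<open>Outerplanar graphs\<close>

text \<open>
  The plane is the type of complex numbers. A vertex \<open>v\<close> is drawn at the point \<open>pos v\<close>, and an
  edge \<open>e\<close> as an arbitrary (not necessarily polygonal) arc \<open>\<gamma> e\<close>.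
\<close>
definition plane_embedding ::
    "'a ugraph \<Rightarrow> ('a \<Rightarrow> complex) \<Rightarrow> ('a set \<Rightarrow> real \<Rightarrow> complex) \<Rightarrow> bool" where
  "plane_embedding G pos \<gamma> \<longleftrightarrow>
     inj_on pos (verts G) \<and>
     (\<forall>e\<in>edges G. arc (\<gamma> e) \<and> {pathstart (\<gamma> e), pathfinish (\<gamma> e)} = pos ` e) \<and>
     (\<forall>e\<in>edges G. path_image (\<gamma> e) \<inter> pos ` verts G = pos ` e) \<and>
     (\<forall>e\<in>edges G. \<forall>f\<in>edges G. e \<noteq> f \<longrightarrow>
        path_image (\<gamma> e) \<inter> path_image (\<gamma> f) = pos ` (e \<inter> f))"

definition drawing ::
    "'a ugraph \<Rightarrow> ('a \<Rightarrow> complex) \<Rightarrow> ('a set \<Rightarrow> real \<Rightarrow> complex) \<Rightarrow> complex set" where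
  "drawing G pos \<gamma> = pos ` verts G \<union> (\<Union>e\<in>edges G. path_image (\<gamma> e))"

text \<open>
  As the drawing of a finite graph is compact, its complement has exactly one unbounded component,
  the outer face; it is the set \<^const>\<open>outside\<close> of the drawing.
\<close>
definition outerplanar :: "'a ugraph \<Rightarrow> bool" where
  "outerplanar G \<longleftrightarrow>
     (\<exists>pos \<gamma>. plane_embedding G pos \<gamma> \<and>
        pos ` verts G \<subseteq> frontier (outside (drawing G pos \<gamma>)))"

section \<open>Correspondence covers and defective colorings\<close>

text \<open>
  \<open>{L v | v \<in> verts G}\<close> is read as an indexed family: the lists of distinct vertices are disjoint.
  Empty lists are not excluded here; they do not occur in a \<open>k\<close>-fold cover with \<open>k \<ge> 1\<close>.
\<close>
definition correspondence_cover :: "'a ugraph \<Rightarrow> ('a \<Rightarrow> 'c set) \<Rightarrow> 'c ugraph \<Rightarrow> bool" where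
  "correspondence_cover G L H \<longleftrightarrow>
     simple_graph H \<and>
     disjoint_family_on L (verts G) \<and> (\<Union>v\<in>verts G. L v) = verts H \<and>
     (\<forall>v\<in>verts G. independent_set H (L v)) \<and>
     (\<forall>u\<in>verts G. \<forall>v\<in>verts G.
        matching (edges (induced_subgraph H (L u \<union> L v))) \<and>
        ({u, v} \<notin> edges G \<longrightarrow> edges (induced_subgraph H (L u \<union> L v)) = {}))"

definition fold_cover :: "nat \<Rightarrow> 'a ugraph \<Rightarrow> ('a \<Rightarrow> 'c set) \<Rightarrow> bool" where
  "fold_cover k G L \<longleftrightarrow> (\<forall>v\<in>verts G. k \<le> card (L v))"

definition cover_coloring :: "'a ugraph \<Rightarrow> ('a \<Rightarrow> 'c set) \<Rightarrow> ('a \<Rightarrow> 'c) \<Rightarrow> bool" where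
  "cover_coloring G L \<phi> \<longleftrightarrow> (\<forall>v\<in>verts G. \<phi> v \<in> L v)"

definition defective :: "nat \<Rightarrow> 'a ugraph \<Rightarrow> 'c ugraph \<Rightarrow> ('a \<Rightarrow> 'c) \<Rightarrow> bool" where
  "defective d G H \<phi> \<longleftrightarrow> max_degree_at_most (induced_subgraph H (\<phi> ` verts G)) d"

text \<open>
  HOL cannot quantify over the type of colors inside a formula, so it is a parameter. Cover graphs
  being finite, every infinite type yields the same notion up to renaming of colors.
\<close>
definition defective_correspondable :: "'c itself \<Rightarrow> nat \<Rightarrow> nat \<Rightarrow> 'a ugraph \<Rightarrow> bool" where
  "defective_correspondable (_ :: 'c itself) d k G \<longleftrightarrow>
     (\<forall>(L :: 'a \<Rightarrow> 'c set) (H :: 'c ugraph).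
        correspondence_cover G L H \<and> fold_cover k G L \<longrightarrow>
        (\<exists>\<phi>. cover_coloring G L \<phi> \<and> defective d G H \<phi>))"

end

(* A drawing witnessing outerplanarity cannot have a vertex inside a closed curve made of edges. Hence
   the graph contains no three internally disjoint paths of length at least two with common ends (one
   of the three arcs would run inside the other two) and no cycle with two crossing chord paths. From
   these two facts one gets a vertex order in which no two edges cross: remove a vertex of degree
   at most two, and split what lies between its two neighbours recursively at a cut vertex.
   For the colouring, an interval of this order with coloured ends u, v is treated by induction so
   that one prescribed end receives no conflict from inside and the other at most one. The interval
   is split at a vertex w over which no edge passes except possibly uv; w avoids the colour of the
   prescribed end, so it meets at most one conflict with the other end and at most one in each of the
   two smaller intervals.
   For sharpness, a hub with at most two conflicts has none with one of three blocks, whose four path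
   vertices then agree; the twist on the triangle over the middle edge gives one of the two middle
   vertices a third conflict. *)
theory Submission
  imports Defs "HOL-Library.Sublist"
begin

section \<open>Lists and walks\<close>

text \<open>Edges are arbitrary arcs and the graph may be disconnected, so the boundary of the outer
  face need not be a closed curve from which an order could be read off. Geometry therefore only
  excludes subdivisions of K(2,3) and K4; the rest concerns an abstract relation. The obstacle in
  the recursion is that both ends of a noncrossing order cannot be prescribed in general: a 4-cycle
  has no such order from a vertex to the opposite one. Each recursive call hence carries a path
  outside the current set that joins the two ends. It serves as the third path of a theta or closes
  the cycle of a K4; at the start it is the removed vertex alone. In the colouring, a matching and
  two colours per list let a vertex avoid just one given colour. This forces the asymmetric
  invariant with one protected end. The gadget has 16 = 1 + 3 * 5 vertices: a hub that tolerates two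
  conflicts must face three blocks.\<close>

text \<open>The forbidden configurations are stated with one long \<open>distinct\<close> list.
  Regrouping, reversing or dropping its segments becomes a multiset computation for
  \<open>simp\<close>.\<close>

lemma distinct_mset_mono: "mset xs \<subseteq># mset ys \<Longrightarrow> distinct ys \<Longrightarrow> distinct xs"
proof (induction xs arbitrary: ys)
  case (Cons x xs)
  then have "x \<in> set ys" by (metis insert_subset_eq_iff mset.simps(2) set_mset_mset)
  then obtain as bs where ys: "ys = as @ x # bs" by (meson split_list)
  with Cons.prems have "mset xs \<subseteq># mset (as @ bs)" by simp
  moreover from this have "set xs \<subseteq> set (as @ bs)" by (metis set_mset_mono set_mset_mset)
  moreover have "distinct (as @ bs)" "x \<notin> set (as @ bs)"
    using Cons.prems ys by auto
  ultimately show ?case using Cons.IH[of "as @ bs"] by auto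
qed simp

lemma successively_split:
  "successively R (xs @ x # ys) \<longleftrightarrow> successively R (xs @ [x]) \<and> successively R (x # ys)"
  by (auto simp: successively_append_iff)

lemma successively_snocI: "successively R xs \<Longrightarrow> R (last xs) y \<Longrightarrow> successively R (xs @ [y])"
  by (simp add: successively_append_iff)

lemma append_eq_four_cases:
  assumes eq: "[a, b, c, d] = xs @ ys"
  obtains "xs = []" "ys = [a, b, c, d]" | "xs = [a]" "ys = [b, c, d]" | "xs = [a, b]" "ys = [c, d]"
    | "xs = [a, b, c]" "ys = [d]" | "xs = [a, b, c, d]" "ys = []"
proof -
  define n where "n = length xs"
  have xs: "xs = take n [a, b, c, d]" and ys: "ys = drop n [a, b, c, d]"
    unfolding eq n_def by simp_all
  have "n \<le> length [a, b, c, d]"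
    unfolding eq n_def by simp
  then consider "n = 0" | "n = 1" | "n = 2" | "n = 3" | "n = 4" by fastforce
  then show thesis
    using that xs ys by cases simp_all
qed

lemma set_subseq_subset: "subseq xs ys \<Longrightarrow> set xs \<subseteq> set ys"
  by (auto dest: list_emb_set)

lemma subseq_snocD: "subseq (xs @ [x]) (ys @ [y]) \<Longrightarrow> subseq xs ys"
proof (induction ys arbitrary: xs)
  case Nil
  then show ?case by (cases xs) (auto split: if_splits)
next
  case (Cons z zs)
  then show ?case by (cases xs) (auto split: if_splits)
qed

text \<open>Used to keep the last vertex of an order from being an inner point of a crossing:
  \<open>c\<close> still has \<open>d\<close> after it.\<close>

lemma subseq_snoc_last:
  assumes "subseq (ps @ c # qs @ [d]) (ys @ [v])" "distinct (ys @ [v])"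
  shows "c \<noteq> v"
proof -
  have "subseq (ps @ c # qs) ys" using assms(1) subseq_snocD[of "ps @ c # qs" d ys v] by simp
  then have "c \<in> set ys" using set_subseq_subset by fastforce
  then show ?thesis using assms(2) by auto
qed

lemma subseq_Cons_hd:
  assumes "subseq (a # ps @ b # qs) (u # ys)" "distinct (u # ys)"
  shows "b \<noteq> u"
proof -
  have "subseq (ps @ b # qs) ys" using assms(1) by (auto split: if_splits dest: subseq_Cons')
  then have "b \<in> set ys" using set_subseq_subset by fastforce
  then show ?thesis using assms(2) by auto
qed

lemma path_of_rtranclp:
  assumes "R\<^sup>*\<^sup>* x y"
  shows "\<exists>p. distinct (x # p) \<and> successively R (x # p) \<and> last (x # p) = y"
  using assms
proof induction
  case base
  show ?case by (rule exI[of _ "[]"]) simp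
next
  case (step y z)
  then obtain p where p: "distinct (x # p)" "successively R (x # p)" "last (x # p) = y" by blast
  show ?case
  \<comment> \<open>Loop erasure: a walk that returns to \<open>z\<close> is cut at the earlier
    occurrence of \<open>z\<close>.\<close>
  proof (cases "z \<in> set (x # p)")
    case True
    then obtain p1 p2 where split: "x # p = p1 @ z # p2" by (meson split_list)
    show ?thesis
    proof (cases p1)
      case Nil
      with split show ?thesis by (intro exI[of _ "[]"]) auto
    next
      case (Cons x' p1')
      then have "p = p1' @ z # p2" "x' = x" using split by auto
      with p show ?thesis
        using successively_split[of R "x # p1'" z p2] by (intro exI[of _ "p1' @ [z]"]) auto
    qed
  next
    case False
    with p step(2) show ?thesis
      using successively_snocI[of R "x # p" z] by (intro exI[of _ "p @ [z]"]) auto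
  qed
qed

lemma successively_rtranclp:
  "successively R (x # p) \<Longrightarrow> y \<in> set (x # p) \<Longrightarrow> R\<^sup>*\<^sup>* x y"
proof (induction p arbitrary: x)
  case (Cons z p)
  then show ?case by (auto intro: converse_rtranclp_into_rtranclp)
qed simp

lemma successively_predecessor:
  "successively R (x # p) \<Longrightarrow> y \<in> set p \<Longrightarrow> \<exists>z. R z y"
  by (induction p arbitrary: x) auto

section \<open>Theta curves in the plane\<close>

text \<open>All arcs are oriented from \<open>a\<close> to \<open>b\<close>, so any one followed by
  the reverse of another is a Jordan curve.\<close>

definition theta :: "(real \<Rightarrow> complex) \<Rightarrow> (real \<Rightarrow> complex) \<Rightarrow> (real \<Rightarrow> complex) \<Rightarrow> complex \<Rightarrow> complex \<Rightarrow> bool" where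
  "theta g1 g2 g3 a b \<longleftrightarrow>
     (\<forall>g\<in>{g1, g2, g3}. arc g \<and> pathstart g = a \<and> pathfinish g = b) \<and>
     path_image g1 \<inter> path_image g2 = {a, b} \<and> path_image g1 \<inter> path_image g3 = {a, b} \<and>
     path_image g2 \<inter> path_image g3 = {a, b}"

lemma Jordan_two_arcs:
  fixes g h :: "real \<Rightarrow> complex"
  assumes "arc g" "pathstart g = a" "pathfinish g = b" "arc h" "pathstart h = a" "pathfinish h = b"
    and "path_image g \<inter> path_image h = {a, b}"
  defines "C \<equiv> path_image g \<union> path_image h"
  shows "inside C \<noteq> {}" "open (inside C)" "connected (inside C)" "connected (outside C)"
    "open (outside C)" "frontier (inside C) = C" "closure (inside C) = inside C \<union> C" "compact C"
proof -
  let ?c = "g +++ reversepath h"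
  have c: "simple_path ?c" "pathfinish ?c = pathstart ?c" "path_image ?c = C"
    using assms by (auto simp: path_image_join intro!: simple_path_join_loop arc_reversepath)
  note J = Jordan_inside_outside[OF c(1,2), unfolded c(3)]
  from J show "inside C \<noteq> {}" "open (inside C)" "connected (inside C)" "connected (outside C)"
    "open (outside C)" "frontier (inside C) = C" by auto
  then show "closure (inside C) = inside C \<union> C"
    by (simp add: closure_Un_frontier)
  show "compact C"
    using assms by (auto simp: C_def compact_arc_image)
qed

text \<open>Without its ends \<open>g3\<close> is still connected and misses the Jordan curve, so a
  single point decides its side.\<close>

lemma theta_arc_inside:
  assumes th: "theta g1 g2 g3 a b"
    and meets: "(path_image g3 - {a, b}) \<inter> inside (path_image g1 \<union> path_image g2) \<noteq> {}"
  shows "path_image g3 - {a, b} \<subseteq> inside (path_image g1 \<union> path_image g2)"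
proof -
  let ?C = "path_image g1 \<union> path_image g2"
  have J: "open (inside ?C)" "open (outside ?C)"
    using th Jordan_two_arcs(2,5)[of g1 a b g2] by (auto simp: theta_def)
  have con: "connected (path_image g3 - {a, b})"
    using th connected_simple_path_endless[of g3] by (auto simp: theta_def arc_imp_simple_path)
  have "(path_image g3 - {a, b}) \<inter> ?C = {}"
    using th by (auto simp: theta_def)
  then have "path_image g3 - {a, b} \<subseteq> inside ?C \<union> outside ?C"
    using inside_Un_outside[of ?C] by blast
  moreover have "inside ?C \<inter> outside ?C = {}"
    by (rule inside_Int_outside)
  ultimately show ?thesis
    using connectedD[OF con J] meets by blast
qed

text \<open>By \<open>no3\<close> the region inside \<open>g1\<close> and \<open>g2\<close> misses
  the curve of \<open>g1\<close> and \<open>g3\<close>; being connected, it lies on one side of it.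
  The inner side is impossible, since taking closures would carry the open arc \<open>g2\<close>
  inside as well, against \<open>no2\<close>.\<close>

lemma theta_inside_not_nested:
  assumes th: "theta g1 g2 g3 a b"
    and no3: "(path_image g3 - {a, b}) \<inter> inside (path_image g1 \<union> path_image g2) = {}"
    and no2: "(path_image g2 - {a, b}) \<inter> inside (path_image g1 \<union> path_image g3) = {}"
  shows "inside (path_image g1 \<union> path_image g2) \<subseteq> outside (path_image g1 \<union> path_image g3)"
proof -
  let ?C = "path_image g1 \<union> path_image g2" and ?D = "path_image g1 \<union> path_image g3"
  have C: "connected (inside ?C)" "closure (inside ?C) = inside ?C \<union> ?C"
    using th Jordan_two_arcs(3,7)[of g1 a b g2] by (auto simp: theta_def)
  have D: "open (inside ?D)" "open (outside ?D)" "closure (inside ?D) = inside ?D \<union> ?D"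
    using th Jordan_two_arcs(2,5,7)[of g1 a b g3] by (auto simp: theta_def)
  have ab: "a \<in> path_image g1" "b \<in> path_image g1"
    using th by (auto simp: theta_def)
  have "inside ?C \<inter> ?C = {}"
    by (rule inside_no_overlap)
  with no3 ab have "inside ?C \<inter> ?D = {}"
    by blast
  then have "inside ?C \<subseteq> inside ?D \<union> outside ?D"
    using inside_Un_outside[of ?D] by blast
  moreover have "inside ?D \<inter> outside ?D = {}"
    by (rule inside_Int_outside)
  ultimately have disj: "inside ?C \<subseteq> inside ?D \<or> inside ?C \<subseteq> outside ?D"
    using connectedD[OF C(1) D(1,2)] by blast
  have "\<not> inside ?C \<subseteq> inside ?D"
  proof
    assume "inside ?C \<subseteq> inside ?D"
    then have "?C \<subseteq> inside ?D \<union> ?D"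
      using closure_mono C(2) D(3) by (metis Un_subset_iff)
    moreover have "path_image g2 - {a, b} \<noteq> {}"
      using th nonempty_simple_path_endless[of g2] by (auto simp: theta_def arc_imp_simple_path)
    moreover have "(path_image g2 - {a, b}) \<inter> ?D = {}"
      using th by (auto simp: theta_def)
    ultimately show False
      using no2 by blast
  qed
  with disj show ?thesis by blast
qed

text \<open>If no arc runs inside the other two, a point \<open>x\<close> inside \<open>g1 \<union> g2\<close> is outside both other
  cycles, and Janiszewski's theorem joins it to infinity in the complement of all three arcs.\<close>
lemma theta_some_arc_inside:
  assumes th: "theta g1 g2 g3 a b"
  shows "path_image g1 - {a, b} \<subseteq> inside (path_image g2 \<union> path_image g3) \<or>
         path_image g2 - {a, b} \<subseteq> inside (path_image g1 \<union> path_image g3) \<or>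
         path_image g3 - {a, b} \<subseteq> inside (path_image g1 \<union> path_image g2)"
proof (rule ccontr)
  assume not: "\<not> ?thesis"
  let ?P1 = "path_image g1" and ?P2 = "path_image g2" and ?P3 = "path_image g3"
  have th': "theta g2 g3 g1 a b" "theta g3 g1 g2 a b" "theta g2 g1 g3 a b" "theta g1 g3 g2 a b"
    using th by (auto simp: theta_def)
  have no1: "(?P1 - {a, b}) \<inter> inside (?P2 \<union> ?P3) = {}"
    using theta_arc_inside[OF th'(1)] not by auto
  have no2: "(?P2 - {a, b}) \<inter> inside (?P1 \<union> ?P3) = {}"
    using theta_arc_inside[OF th'(4)] not by auto
  have no3: "(?P3 - {a, b}) \<inter> inside (?P1 \<union> ?P2) = {}"
    using theta_arc_inside[OF th] not by auto
  have out13: "inside (?P1 \<union> ?P2) \<subseteq> outside (?P1 \<union> ?P3)"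
    using theta_inside_not_nested[OF th no3 no2] .
  have out23: "inside (?P1 \<union> ?P2) \<subseteq> outside (?P2 \<union> ?P3)"
    using theta_inside_not_nested[OF th'(3)] no3 no1 by (simp add: Un_commute)
  have J13: "connected (outside (?P1 \<union> ?P3))" "compact (?P1 \<union> ?P3)"
    using th Jordan_two_arcs(4,8)[of g1 a b g3] by (auto simp: theta_def)
  have J23: "connected (outside (?P2 \<union> ?P3))" "compact (?P2 \<union> ?P3)"
    using th Jordan_two_arcs(4,8)[of g2 a b g3] by (auto simp: theta_def)
  have J12: "inside (?P1 \<union> ?P2) \<noteq> {}"
    using th Jordan_two_arcs(1)[of g1 a b g2] by (auto simp: theta_def)
  then obtain x where x: "x \<in> inside (?P1 \<union> ?P2)" by blast
  let ?T = "?P1 \<union> ?P3 \<union> (?P2 \<union> ?P3)"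
  have "bounded ?T"
    using J13(2) J23(2) by (meson bounded_Un compact_imp_bounded)
  then have "outside ?T \<noteq> {}"
    by (metis outside_bounded_nonempty)
  then obtain y where y: "y \<in> outside ?T" by blast
  have y': "y \<in> outside (?P1 \<union> ?P2)" "y \<in> outside (?P1 \<union> ?P3)" "y \<in> outside (?P2 \<union> ?P3)"
    using y outside_mono[of "?P1 \<union> ?P2" ?T] outside_mono[of "?P1 \<union> ?P3" ?T]
      outside_mono[of "?P2 \<union> ?P3" ?T] by blast+
  have outside_subset: "outside S \<subseteq> - S" for S :: "complex set"
    using inside_Un_outside[of S] by blast
  have "connected_component (- (?P1 \<union> ?P3)) x y"
    unfolding connected_component_def using out13 x y'(2) J13(1) outside_subset by blast
  moreover have "connected_component (- (?P2 \<union> ?P3)) x y"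
    unfolding connected_component_def using out23 x y'(3) J23(1) outside_subset by blast
  \<comment> \<open>Janiszewski's theorem asks for a connected intersection of the two compact sets;
    here it is the common arc \<open>g3\<close>.\<close>
  moreover have "connected ((?P1 \<union> ?P3) \<inter> (?P2 \<union> ?P3))"
  proof -
    have "{a, b} \<subseteq> ?P3"
      using th by (auto simp: theta_def)
    then have "(?P1 \<union> ?P3) \<inter> (?P2 \<union> ?P3) = ?P3"
      using th by (auto simp: theta_def)
    then show ?thesis
      using th by (auto simp: theta_def connected_arc_image)
  qed
  ultimately have "connected_component (- ?T) x y"
    using Janiszewski J13(2) J23(2) compact_imp_closed by blast
  \<comment> \<open>Forgetting \<open>g3\<close>, a point inside a Jordan curve is joined to a point
    outside the same curve.\<close>
  then have "connected_component (- (?P1 \<union> ?P2)) x y"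
    by (rule connected_component_of_subset) auto
  then show False
    using x y'(1) by (metis inside_same_component outside_same_component disjoint_iff inside_Int_outside)
qed

text \<open>The open arc is the image of the open unit interval, and continuity respects closures.
  Thus an open arc inside a region has its ends in the closure of that region.\<close>

lemma endpoints_in_closure_arc:
  assumes "arc g"
  shows "path_image g \<subseteq> closure (path_image g - {pathstart g, pathfinish g})"
proof -
  have "continuous_on {0..1} g"
    using assms by (auto simp: arc_def path_def)
  then have "g ` closure {0<..<1} \<subseteq> closure (g ` {0<..<1})"
    by (intro continuous_image_closure_subset) auto
  then show ?thesis
    using simple_path_endless[of g] assms by (simp add: arc_imp_simple_path path_image_def)
qed

text \<open>A chord of a closed curve splits its inside into two regions, and a crossing chord would have
  to lie in one of them, which would swallow \<open>b\<close> or \<open>d\<close>.\<close>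
lemma crossing_chords_swallow:
  assumes th: "theta g1 g2 x a c" and y: "arc y" "pathstart y = b" "pathfinish y = d"
    and b: "b \<in> path_image g1 - {a, c}" and d: "d \<in> path_image g2 - {a, c}"
    and x_in: "path_image x - {a, c} \<subseteq> inside (path_image g1 \<union> path_image g2)"
    and y_in: "path_image y - {b, d} \<subseteq> inside (path_image g1 \<union> path_image g2)"
    and disj: "path_image x \<inter> path_image y = {}"
  shows "b \<in> inside (path_image g2 \<union> path_image x) \<or> d \<in> inside (path_image g1 \<union> path_image x)"
proof -
  let ?R1 = "inside (path_image g1 \<union> path_image x)" and ?R2 = "inside (path_image g2 \<union> path_image x)"
  have ac: "a \<noteq> c" using th arc_distinct_ends[of x] by (auto simp: theta_def)
  have sp: "simple_path g1" "simple_path g2" "simple_path x"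
    using th by (auto simp: theta_def arc_imp_simple_path)
  have ne: "path_image x - {a, c} \<noteq> {}"
    using nonempty_simple_path_endless[OF sp(3)] th by (auto simp: theta_def)
  obtain "?R1 \<inter> ?R2 = {}"
    and un: "?R1 \<union> ?R2 \<union> (path_image x - {a, c}) = inside (path_image g1 \<union> path_image g2)"
    using split_inside_simple_closed_curve[OF sp(1) _ _ sp(2) _ _ sp(3) _ _ ac] th x_in ne
    by (auto simp: theta_def)
  have R1: "open ?R1" "closure ?R1 = ?R1 \<union> (path_image g1 \<union> path_image x)"
    using th Jordan_two_arcs(2,7)[of g1 a c x] by (auto simp: theta_def)
  have R2: "open ?R2" "closure ?R2 = ?R2 \<union> (path_image g2 \<union> path_image x)"
    using th Jordan_two_arcs(2,7)[of g2 a c x] by (auto simp: theta_def)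
  have "path_image y - {b, d} \<subseteq> ?R1 \<union> ?R2"
    using y_in un disj by blast
  moreover have "connected (path_image y - {b, d})"
    using connected_simple_path_endless[of y] y by (auto simp: arc_imp_simple_path)
  ultimately have "path_image y - {b, d} \<subseteq> ?R1 \<or> path_image y - {b, d} \<subseteq> ?R2"
    using connectedD[OF _ R1(1) R2(1)] \<open>?R1 \<inter> ?R2 = {}\<close> by blast
  then have "path_image y \<subseteq> closure ?R1 \<or> path_image y \<subseteq> closure ?R2"
    using endpoints_in_closure_arc[OF y(1)] y closure_mono by (metis subset_trans)
  moreover have "b \<in> path_image y" "d \<in> path_image y"
    using y by auto
  \<comment> \<open>If \<open>y\<close> runs in \<open>?R1\<close>, then \<open>d\<close> is in its
    closure; as \<open>d\<close> lies on \<open>g2\<close> away from the two bounding arcs, it is in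
    \<open>?R1\<close> itself. The case of \<open>?R2\<close> is the same with
    \<open>b\<close>.\<close>
  ultimately have "d \<in> ?R1 \<union> (path_image g1 \<union> path_image x) \<or> b \<in> ?R2 \<union> (path_image g2 \<union> path_image x)"
    using R1(2) R2(2) by blast
  moreover have "d \<notin> path_image g1 \<union> path_image x" "b \<notin> path_image g2 \<union> path_image x"
    using th b d by (auto simp: theta_def)
  ultimately show ?thesis by blast
qed

section \<open>Subdivisions excluded by an outerplanar drawing\<close>

abbreviation adj :: "'a ugraph \<Rightarrow> 'a \<Rightarrow> 'a \<Rightarrow> bool" where
  "adj G x y \<equiv> {x, y} \<in> edges G"

fun path_edges :: "'a list \<Rightarrow> 'a set set" where
  "path_edges (x # y # xs) = insert {x, y} (path_edges (y # xs))"
| "path_edges _ = {}"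

lemma path_edges_append: "path_edges (xs @ x # ys) = path_edges (xs @ [x]) \<union> path_edges (x # ys)"
proof (induction xs)
  case (Cons z zs) then show ?case by (cases zs) auto
qed auto

lemma path_edges_rev [simp]: "path_edges (rev xs) = path_edges xs"
proof (induction xs rule: path_edges.induct)
  case (1 x y xs)
  then show ?case
    using path_edges_append[of "rev xs" y "[x]"] by (simp add: insert_commute)
qed auto

lemma path_edges_subset_Pow: "e \<in> path_edges xs \<Longrightarrow> e \<subseteq> set xs"
  by (induction xs rule: path_edges.induct) auto

lemma Union_path_edges: "2 \<le> length xs \<Longrightarrow> \<Union> (path_edges xs) = set xs"
proof (induction xs rule: path_edges.induct)
  case (1 x y xs) then show ?case by (cases xs) auto
qed auto

lemma card_path_edge: "distinct xs \<Longrightarrow> e \<in> path_edges xs \<Longrightarrow> card e = 2"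
  by (induction xs rule: path_edges.induct) auto

lemma path_edges_subset_edges: "successively (adj G) xs \<Longrightarrow> path_edges xs \<subseteq> edges G"
  by (induction xs rule: path_edges.induct) auto

lemma ends_notin_path_edges:
  assumes "distinct (a # P @ [b])" "P \<noteq> []"
  shows "{a, b} \<notin> path_edges (a # P @ [b])"
proof -
  obtain p Q where P: "P = p # Q" using assms by (cases P) auto
  show ?thesis
    using assms path_edges_subset_Pow[of "{a, b}" "p # Q @ [b]"] by (auto simp: P doubleton_eq_iff)
qed

text \<open>A common edge can only join the common vertices \<open>a\<close> and \<open>b\<close>,
  but a path with an inner vertex does not use that edge. Nonemptiness is asked of \<open>P\<close>
  alone, so that the second path may be a single edge.\<close>

lemma path_edges_disjoint:
  assumes "distinct (a # b # P @ Q)" "P \<noteq> []"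
  shows "path_edges (a # P @ [b]) \<inter> path_edges (a # Q @ [b]) = {}"
proof (rule ccontr)
  assume "\<not> ?thesis"
  then obtain e where e: "e \<in> path_edges (a # P @ [b])" "e \<in> path_edges (a # Q @ [b])" by blast
  then have "e \<subseteq> {a, b}"
    using path_edges_subset_Pow[OF e(1)] path_edges_subset_Pow[OF e(2)] assms by auto
  moreover have "card e = 2"
    using e assms by (intro card_path_edge[of "a # P @ [b]"]) auto
  ultimately have "e = {a, b}"
    using assms by (intro card_subset_eq) auto
  with e ends_notin_path_edges[of a P b] assms show False by auto
qed

lemma successively_adj_rev [simp]: "successively (adj G) (rev xs) = successively (adj G) xs"
  by (simp add: insert_commute)

locale outerplane_graph =
  fixes G :: "'a ugraph" and pos :: "'a \<Rightarrow> complex" and \<gamma> :: "'a set \<Rightarrow> real \<Rightarrow> complex"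
  assumes simple: "simple_graph G"
    and embedding: "plane_embedding G pos \<gamma>"
    and outer: "pos ` verts G \<subseteq> frontier (outside (drawing G pos \<gamma>))"
begin

definition image_of :: "'a list \<Rightarrow> complex set" where
  "image_of xs = (\<Union>e\<in>path_edges xs. path_image (\<gamma> e))"

lemma set_subset_verts:
  assumes "successively (adj G) xs" "2 \<le> length xs"
  shows "set xs \<subseteq> verts G"
proof -
  have "e \<subseteq> verts G" if "e \<in> path_edges xs" for e
    using that path_edges_subset_edges[OF assms(1)] simple by (auto simp: simple_graph_def)
  then show ?thesis
    using Union_path_edges[OF assms(2)] by blast
qed

lemma pos_in_image_of:
  assumes "successively (adj G) xs" "2 \<le> length xs" "v \<in> set xs"
  shows "pos v \<in> image_of xs"
proof -
  obtain e where e: "e \<in> path_edges xs" "v \<in> e"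
    using assms Union_path_edges[of xs] by blast
  then have "e \<in> edges G" using path_edges_subset_edges assms by blast
  then have "path_image (\<gamma> e) \<inter> pos ` verts G = pos ` e"
    using embedding by (auto simp: plane_embedding_def)
  with e(2) have "pos v \<in> path_image (\<gamma> e)" by blast
  with e show ?thesis by (auto simp: image_of_def)
qed

lemma image_of_subset_drawing: "successively (adj G) xs \<Longrightarrow> image_of xs \<subseteq> drawing G pos \<gamma>"
  using path_edges_subset_edges[of G xs] by (auto simp: image_of_def drawing_def)

text \<open>Arcs of distinct edges meet exactly at shared ends, and edge-disjointness makes every
  pair distinct. Each path has an edge, so the unions of the edges are the vertex sets.\<close>

lemma image_of_Int:
  assumes "successively (adj G) xs" "2 \<le> length xs" "successively (adj G) ys" "2 \<le> length ys"
    and disj: "path_edges xs \<inter> path_edges ys = {}"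
  shows "image_of xs \<inter> image_of ys = pos ` (set xs \<inter> set ys)"
proof -
  have "path_image (\<gamma> e) \<inter> path_image (\<gamma> f) = pos ` (e \<inter> f)"
    if "e \<in> path_edges xs" "f \<in> path_edges ys" for e f
  proof -
    have "e \<in> edges G" "f \<in> edges G" "e \<noteq> f"
      using that disj path_edges_subset_edges[OF assms(1)] path_edges_subset_edges[OF assms(3)] by auto
    then show ?thesis
      using embedding by (simp add: plane_embedding_def)
  qed
  then have rewrite: "(\<Union>e\<in>path_edges xs. \<Union>f\<in>path_edges ys. path_image (\<gamma> e) \<inter> path_image (\<gamma> f)) =
      (\<Union>e\<in>path_edges xs. \<Union>f\<in>path_edges ys. pos ` (e \<inter> f))"
    by simp
  have "image_of xs \<inter> image_of ys =
      (\<Union>e\<in>path_edges xs. \<Union>f\<in>path_edges ys. path_image (\<gamma> e) \<inter> path_image (\<gamma> f))"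
    unfolding image_of_def by blast
  also note rewrite
  also have "(\<Union>e\<in>path_edges xs. \<Union>f\<in>path_edges ys. pos ` (e \<inter> f)) = pos ` (\<Union> (path_edges xs) \<inter> \<Union> (path_edges ys))"
    by blast
  finally show ?thesis using assms by (simp add: Union_path_edges)
qed

text \<open>\<open>\<gamma>\<close> is indexed by unordered edges, so its arc may run from
  \<open>y\<close> to \<open>x\<close> and is then reversed.\<close>

lemma edge_arc:
  assumes "adj G x y" "x \<noteq> y"
  obtains g where "arc g" "pathstart g = pos x" "pathfinish g = pos y"
    "path_image g = path_image (\<gamma> {x, y})"
proof (cases "pathstart (\<gamma> {x, y}) = pos x")
  case True
  have "arc (\<gamma> {x, y})" "{pathstart (\<gamma> {x, y}), pathfinish (\<gamma> {x, y})} = {pos x, pos y}"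
    using assms embedding by (auto simp: plane_embedding_def)
  with True that show ?thesis by (metis doubleton_eq_iff)
next
  case False
  have "arc (\<gamma> {x, y})" "{pathstart (\<gamma> {x, y}), pathfinish (\<gamma> {x, y})} = {pos x, pos y}"
    using assms embedding by (auto simp: plane_embedding_def)
  with False that[of "reversepath (\<gamma> {x, y})"] show ?thesis
    by (auto simp: arc_reversepath doubleton_eq_iff)
qed

lemma path_arc:
  assumes "distinct xs" "2 \<le> length xs" "successively (adj G) xs"
  obtains g where "arc g" "pathstart g = pos (hd xs)" "pathfinish g = pos (last xs)"
    "path_image g = image_of xs"
  using assms
proof (induction xs arbitrary: thesis rule: path_edges.induct)
  case (1 x y xs)
  obtain g where g: "arc g" "pathstart g = pos x" "pathfinish g = pos y" "path_image g = image_of [x, y]"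
    using edge_arc[of x y] 1 by (auto simp: image_of_def)
  show ?case
  proof (cases "xs = []")
    case True
    with g 1 show ?thesis by auto
  next
    case False
    then obtain h where h: "arc h" "pathstart h = pos y" "pathfinish h = pos (last (y # xs))"
      "path_image h = image_of (y # xs)"
      using 1 by (cases xs) (auto split: if_splits)
    have "path_edges [x, y] \<inter> path_edges (y # xs) = {}"
      using 1 path_edges_subset_Pow[of "{x, y}" "y # xs"] by auto
    then have "image_of [x, y] \<inter> image_of (y # xs) = pos ` (set [x, y] \<inter> set (y # xs))"
      using 1 False by (intro image_of_Int) (auto simp: Suc_le_eq)
    then have "path_image g \<inter> path_image h \<subseteq> {pathstart h}"
      using g h 1 by auto
    then have "arc (g +++ h)" using g h by (intro arc_join) auto
    moreover have "path_image (g +++ h) = image_of (x # y # xs)"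
      using g h by (auto simp: path_image_join image_of_def)
    ultimately show ?thesis using 1(2)[of "g +++ h"] g h by auto
  qed
qed auto

text \<open>The only use of \<open>outer\<close>. A vertex is a limit of points outside the drawing,
  so an open \<open>inside S\<close> around it would contain such a point, which is however outside
  the smaller set \<open>S\<close>.\<close>

lemma pos_notin_inside:
  assumes "v \<in> verts G" "S \<subseteq> drawing G pos \<gamma>" "open (inside S)"
  shows "pos v \<notin> inside S"
proof
  assume "pos v \<in> inside S"
  moreover have "pos v \<in> closure (outside (drawing G pos \<gamma>))"
    using assms outer by (auto simp: frontier_def)
  ultimately have "inside S \<inter> outside (drawing G pos \<gamma>) \<noteq> {}"
    using assms open_Int_closure_eq_empty by blast
  moreover have "outside (drawing G pos \<gamma>) \<subseteq> outside S"
    using assms by (intro outside_mono)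
  ultimately show False
    using inside_Int_outside[of S] by blast
qed

text \<open>Some arc runs inside the other two. The arcs of \<open>P\<close> and \<open>Q\<close>
  carry a vertex, which cannot lie inside, so it is the arc of \<open>X\<close>. An empty
  \<open>X\<close> covers a chord that is one edge.\<close>

lemma theta_of_paths:
  assumes "distinct (a # c # P @ Q @ X)" "P \<noteq> []" "Q \<noteq> []"
    and succ: "successively (adj G) (a # P @ [c])" "successively (adj G) (a # Q @ [c])"
      "successively (adj G) (a # X @ [c])"
  obtains g h x where "theta g h x (pos a) (pos c)" "path_image g = image_of (a # P @ [c])"
    "path_image h = image_of (a # Q @ [c])" "path_image x = image_of (a # X @ [c])"
    "path_image x - {pos a, pos c} \<subseteq> inside (path_image g \<union> path_image h)"
proof -
  obtain g where g: "arc g" "pathstart g = pos a" "pathfinish g = pos c"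
    "path_image g = image_of (a # P @ [c])"
    using path_arc[OF _ _ succ(1)] assms(1) by auto
  obtain h where h: "arc h" "pathstart h = pos a" "pathfinish h = pos c"
    "path_image h = image_of (a # Q @ [c])"
    using path_arc[OF _ _ succ(2)] assms(1) by auto
  obtain x where x: "arc x" "pathstart x = pos a" "pathfinish x = pos c"
    "path_image x = image_of (a # X @ [c])"
    using path_arc[OF _ _ succ(3)] assms(1) by auto
  have "path_image g \<inter> path_image h = pos ` (set (a # P @ [c]) \<inter> set (a # Q @ [c]))"
    unfolding g h by (intro image_of_Int succ path_edges_disjoint) (use assms in auto)
  moreover have "path_image g \<inter> path_image x = pos ` (set (a # P @ [c]) \<inter> set (a # X @ [c]))"
    unfolding g x by (intro image_of_Int succ path_edges_disjoint) (use assms in auto)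
  moreover have "path_image h \<inter> path_image x = pos ` (set (a # Q @ [c]) \<inter> set (a # X @ [c]))"
    unfolding h x by (intro image_of_Int succ path_edges_disjoint) (use assms in auto)
  moreover have "set (a # P @ [c]) \<inter> set (a # Q @ [c]) = {a, c}" "set (a # P @ [c]) \<inter> set (a # X @ [c]) = {a, c}"
    "set (a # Q @ [c]) \<inter> set (a # X @ [c]) = {a, c}"
    using assms(1) by auto
  ultimately have "path_image g \<inter> path_image h = {pos a, pos c}"
    "path_image g \<inter> path_image x = {pos a, pos c}" "path_image h \<inter> path_image x = {pos a, pos c}"
    by (simp_all only: image_insert image_empty)
  then have th: "theta g h x (pos a) (pos c)"
    using g(1-3) h(1-3) x(1-3) by (simp add: theta_def)
  have V: "set P \<subseteq> verts G" "set Q \<subseteq> verts G" "a \<in> verts G" "c \<in> verts G"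
    using set_subset_verts[OF succ(1)] set_subset_verts[OF succ(2)] by auto
  have inj: "inj_on pos (verts G)"
    using embedding by (simp add: plane_embedding_def)
  have interior: "pos (hd R) \<in> image_of (a # R @ [c]) - {pos a, pos c}"
    if "R \<noteq> []" "set R \<subseteq> verts G" "successively (adj G) (a # R @ [c])" "distinct (a # c # R)" for R
  proof -
    have "hd R \<in> set R" using that by simp
    then have "hd R \<in> verts G" "hd R \<noteq> a" "hd R \<noteq> c" using that by auto
    then have "pos (hd R) \<notin> {pos a, pos c}" using inj V by (auto dest: inj_onD)
    moreover have "pos (hd R) \<in> image_of (a # R @ [c])"
      using that by (intro pos_in_image_of) auto
    ultimately show ?thesis by blast
  qed
  have dr: "path_image g \<subseteq> drawing G pos \<gamma>" "path_image h \<subseteq> drawing G pos \<gamma>" "path_image x \<subseteq> drawing G pos \<gamma>"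
    unfolding g h x by (intro image_of_subset_drawing succ)+
  have "open (inside (path_image h \<union> path_image x))" "open (inside (path_image g \<union> path_image x))"
    using th Jordan_two_arcs(2)[of h "pos a" "pos c" x] Jordan_two_arcs(2)[of g "pos a" "pos c" x]
    by (auto simp: theta_def)
  then have "pos (hd P) \<notin> inside (path_image h \<union> path_image x)" "pos (hd Q) \<notin> inside (path_image g \<union> path_image x)"
    using dr V hd_in_set[OF assms(2)] hd_in_set[OF assms(3)]
      pos_notin_inside[of "hd P" "path_image h \<union> path_image x"]
      pos_notin_inside[of "hd Q" "path_image g \<union> path_image x"] by blast+
  moreover have "pos (hd P) \<in> path_image g - {pos a, pos c}" "pos (hd Q) \<in> path_image h - {pos a, pos c}"
    unfolding g h by (intro interior succ V; use assms in auto)+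
  ultimately have "path_image x - {pos a, pos c} \<subseteq> inside (path_image g \<union> path_image h)"
    using theta_some_arc_inside[OF th] by blast
  with th g h x that show ?thesis by blast
qed

text \<open>The third path now carries a vertex too, so it cannot run inside either. This is a
  subdivision of K(2,3).\<close>

lemma no_theta_subdivision:
  assumes "distinct (a # c # P @ Q @ X)" "P \<noteq> []" "Q \<noteq> []" "X \<noteq> []"
    and "successively (adj G) (a # P @ [c])" "successively (adj G) (a # Q @ [c])"
      "successively (adj G) (a # X @ [c])"
  shows False
proof -
  obtain g h x where th: "theta g h x (pos a) (pos c)" "path_image g = image_of (a # P @ [c])"
    "path_image h = image_of (a # Q @ [c])" "path_image x = image_of (a # X @ [c])"
    and ins: "path_image x - {pos a, pos c} \<subseteq> inside (path_image g \<union> path_image h)"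
    using theta_of_paths[OF assms(1-3) assms(5-7)] .
  have V: "set X \<subseteq> verts G" "a \<in> verts G" "c \<in> verts G"
    using set_subset_verts[OF assms(7)] by auto
  have hd: "hd X \<in> set X" using assms by simp
  have "pos (hd X) \<in> path_image x"
    unfolding th by (rule pos_in_image_of) (use assms hd in auto)
  moreover have "pos (hd X) \<notin> {pos a, pos c}"
    using embedding V hd assms(1) by (auto simp: plane_embedding_def dest!: inj_onD)
  ultimately have "pos (hd X) \<in> inside (path_image g \<union> path_image h)"
    using ins by blast
  moreover have "pos (hd X) \<notin> inside (path_image g \<union> path_image h)"
  proof (rule pos_notin_inside)
    show "hd X \<in> verts G" using V hd by blast
    show "path_image g \<union> path_image h \<subseteq> drawing G pos \<gamma>"
      unfolding th using image_of_subset_drawing assms by blast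
    show "open (inside (path_image g \<union> path_image h))"
      using th(1) Jordan_two_arcs(2)[of g "pos a" "pos c" h] by (auto simp: theta_def)
  qed
  ultimately show False by blast
qed

text \<open>A cycle with crossing chord paths \<open>X\<close> and \<open>Y\<close> is a subdivision
  of K4. \<open>theta_of_paths\<close> puts each chord inside the cycle, and then crossing forces
  \<open>b\<close> or \<open>d\<close> inside a closed curve.\<close>

lemma no_K4_subdivision:
  assumes dist: "distinct (a # P1 @ b # P2 @ c # P3 @ d # P4 @ X @ Y)"
    and cyc: "successively (adj G) (a # P1 @ b # P2 @ c # P3 @ d # P4 @ [a])"
    and X: "successively (adj G) (a # X @ [c])" and Y: "successively (adj G) (b # Y @ [d])"
  shows False
proof -
  \<comment> \<open>The same cycle is cut once at \<open>a\<close> and \<open>c\<close>, once at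
    \<open>b\<close> and \<open>d\<close>. One arc of each cut is later reversed, because both arcs
    of a theta start at the same vertex.\<close>
  let ?abc = "a # (P1 @ b # P2) @ [c]" and ?cda = "c # (P3 @ d # P4) @ [a]"
  let ?bcd = "b # (P2 @ c # P3) @ [d]" and ?dab = "d # (P4 @ a # P1) @ [b]"
  have cda_rev: "rev ?cda = a # (rev P4 @ d # rev P3) @ [c]" by simp
  have dab_rev: "rev ?dab = b # (rev P1 @ a # rev P4) @ [d]" by simp
  have arcs: "successively (adj G) (a # P1 @ [b])" "successively (adj G) (b # P2 @ [c])"
    "successively (adj G) (c # P3 @ [d])" "successively (adj G) (d # P4 @ [a])"
    using cyc successively_split[of "adj G" "a # P1" b "P2 @ c # P3 @ d # P4 @ [a]"]
      successively_split[of "adj G" "b # P2" c "P3 @ d # P4 @ [a]"]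
      successively_split[of "adj G" "c # P3" d "P4 @ [a]"] by auto
  have S: "successively (adj G) ?abc" "successively (adj G) (rev ?cda)"
    "successively (adj G) ?bcd" "successively (adj G) (rev ?dab)"
    unfolding successively_adj_rev using arcs
      successively_split[of "adj G" "a # P1" b "P2 @ [c]"] successively_split[of "adj G" "c # P3" d "P4 @ [a]"]
      successively_split[of "adj G" "b # P2" c "P3 @ [d]"] successively_split[of "adj G" "d # P4" a "P1 @ [b]"]
    by auto
  have edges1: "path_edges ?abc \<union> path_edges ?cda = path_edges (a # P1 @ b # P2 @ c # P3 @ d # P4 @ [a])"
    using path_edges_append[of "a # P1 @ b # P2" c "P3 @ d # P4 @ [a]"] by simp
  have edges2: "path_edges ?bcd \<union> path_edges ?dab = path_edges (a # P1 @ b # P2 @ c # P3 @ d # P4 @ [a])"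
    using path_edges_append[of "a # P1" b "P2 @ c # P3 @ d # P4 @ [a]"]
      path_edges_append[of "b # P2 @ c # P3" d "P4 @ [a]"]
      path_edges_append[of "d # P4" a "P1 @ [b]"] by auto
  have image_rev: "image_of (rev xs) = image_of xs" for xs
    by (simp add: image_of_def del: rev.simps)
  have dist_ac: "distinct (a # c # (P1 @ b # P2) @ (rev P4 @ d # rev P3) @ X)"
    and dist_bd: "distinct (b # d # (P2 @ c # P3) @ (rev P1 @ a # rev P4) @ Y)"
    by (rule distinct_mset_mono[OF _ dist]; simp)+
  have ne: "P1 @ b # P2 \<noteq> []" "rev P4 @ d # rev P3 \<noteq> []" "P2 @ c # P3 \<noteq> []" "rev P1 @ a # rev P4 \<noteq> []"
    by simp_all
  obtain g h x where th: "theta g h x (pos a) (pos c)" "path_image g = image_of ?abc"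
    "path_image h = image_of (rev ?cda)" "path_image x = image_of (a # X @ [c])"
    and x_in: "path_image x - {pos a, pos c} \<subseteq> inside (path_image g \<union> path_image h)"
    by (rule theta_of_paths[OF dist_ac ne(1,2) S(1) S(2)[unfolded cda_rev] X, folded cda_rev])
  obtain g' h' y where th': "theta g' h' y (pos b) (pos d)" "path_image g' = image_of ?bcd"
    "path_image h' = image_of (rev ?dab)" "path_image y = image_of (b # Y @ [d])"
    and y_in': "path_image y - {pos b, pos d} \<subseteq> inside (path_image g' \<union> path_image h')"
    by (rule theta_of_paths[OF dist_bd ne(3,4) S(3) S(4)[unfolded dab_rev] Y, folded dab_rev])
  have "path_image g \<union> path_image h = path_image g' \<union> path_image h'"
    unfolding th th' image_rev unfolding image_of_def UN_Un[symmetric] edges1 edges2 ..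
  with y_in' have y_in: "path_image y - {pos b, pos d} \<subseteq> inside (path_image g \<union> path_image h)"
    by simp
  have V: "{a, b, c, d} \<subseteq> verts G"
    using set_subset_verts[OF cyc] by auto
  then have pos_ne: "pos b \<notin> {pos a, pos c}" "pos d \<notin> {pos a, pos c}"
    using embedding dist by (auto simp: plane_embedding_def dest!: inj_onD)
  have "image_of (a # X @ [c]) \<inter> image_of (b # Y @ [d]) = pos ` (set (a # X @ [c]) \<inter> set (b # Y @ [d]))"
  proof (rule image_of_Int[OF X _ Y])
    have "set (a # X @ [c]) \<inter> set (b # Y @ [d]) = {}"
      using dist by auto
    then have "e = {}" if "e \<in> path_edges (a # X @ [c])" "e \<in> path_edges (b # Y @ [d])" for e
      using path_edges_subset_Pow[OF that(1)] path_edges_subset_Pow[OF that(2)] by blast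
    moreover have "distinct (a # X @ [c])" using dist by auto
    ultimately show "path_edges (a # X @ [c]) \<inter> path_edges (b # Y @ [d]) = {}"
      using card_path_edge by fastforce
  qed auto
  then have "path_image x \<inter> path_image y = {}"
    unfolding th th' using dist by auto
  then have "pos b \<in> inside (path_image h \<union> path_image x) \<or> pos d \<in> inside (path_image g \<union> path_image x)"
  proof (rule crossing_chords_swallow[OF th(1) _ _ _ _ _ x_in y_in, rotated -1])
    show "arc y" "pathstart y = pos b" "pathfinish y = pos d"
      using th'(1) by (auto simp: theta_def)
    show "pos b \<in> path_image g - {pos a, pos c}"
      using pos_ne unfolding th by (auto intro!: pos_in_image_of S(1)[simplified])
    have "pos d \<in> image_of (rev ?cda)"
      by (rule pos_in_image_of[OF S(2)]) auto
    then show "pos d \<in> path_image h - {pos a, pos c}"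
      using pos_ne unfolding th by auto
  qed
  moreover have dr: "path_image g \<subseteq> drawing G pos \<gamma>" "path_image h \<subseteq> drawing G pos \<gamma>"
    "path_image x \<subseteq> drawing G pos \<gamma>"
    unfolding th by (intro image_of_subset_drawing S X)+
  moreover have "open (inside (path_image h \<union> path_image x))" "open (inside (path_image g \<union> path_image x))"
    using th(1) Jordan_two_arcs(2)[of h "pos a" "pos c" x] Jordan_two_arcs(2)[of g "pos a" "pos c" x]
    by (auto simp: theta_def)
  ultimately show False
    using pos_notin_inside[of b] pos_notin_inside[of d] V by auto
qed

end

section \<open>Noncrossing vertex orders\<close>

text \<open>All that is kept of the drawing. The exclusions range over paths of the whole relation,
  so they also apply to paths that leave the set being ordered.\<close>

locale outerplanar_like =
  fixes E :: "'a \<Rightarrow> 'a \<Rightarrow> bool"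
  assumes sym: "E x y \<Longrightarrow> E y x"
    and irrefl: "\<not> E x x"
    and no_theta: "\<lbrakk>distinct (a # c # P @ Q @ X); P \<noteq> []; Q \<noteq> []; X \<noteq> [];
      successively E (a # P @ [c]); successively E (a # Q @ [c]); successively E (a # X @ [c])\<rbrakk> \<Longrightarrow> False"
    and no_K4: "\<lbrakk>distinct (a # P1 @ b # P2 @ c # P3 @ d # P4 @ X @ Y);
      successively E (a # P1 @ b # P2 @ c # P3 @ d # P4 @ [a]);
      successively E (a # X @ [c]); successively E (b # Y @ [d])\<rbrakk> \<Longrightarrow> False"
begin

section \<open>Longest paths and a vertex of degree at most two\<close>

lemma successively_rev_E [simp]: "successively E (rev xs) \<longleftrightarrow> successively E xs"
proof -
  have swap: "(\<lambda>x y. E y x) = E" using sym by blast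
  show ?thesis unfolding successively_rev swap ..
qed

text \<open>If \<open>t\<close> does not come after \<open>s\<close>, the path from \<open>a\<close>
  to \<open>s\<close> closed by the edge \<open>as\<close> has the crossing chords \<open>ac\<close>
  and \<open>bt\<close>. Otherwise reversing the segment before \<open>c\<close> exchanges
  \<open>a\<close> and \<open>b\<close>: \<open>ac\<close> becomes an edge of the path and
  \<open>bc\<close> a chord.\<close>

lemma long_path_crossing:
  assumes "distinct (a # P @ b # c # R)" and "successively E (a # P @ b # c # R)"
    and "E a c" "E a s" "E b t" "s \<in> set R" "t \<in> set R"
  shows False
proof -
  have crossing: False
    if prem: "distinct (a # P @ b # c # R1 @ t # R2)" "successively E (a # P @ b # c # R1 @ t # R2)"
      "E a c" "E a s" "E b t" "s \<in> set (t # R2)" for a b P R1 t R2 s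
  proof -
    obtain R2' R3 where R2: "R2 = R2' @ R3" and last: "last (t # R2') = s"
    proof (cases "s = t")
      case False
      then obtain as bs where "R2 = as @ s # bs"
        using prem(6) by (auto dest: split_list)
      then show ?thesis using that[of "as @ [s]" bs] by simp
    qed (use that[of "[]" R2] in simp)
    have "distinct (a # P @ b # [] @ c # R1 @ t # R2' @ [] @ [])"
      by (rule distinct_mset_mono[OF _ prem(1)]) (simp add: R2)
    moreover have "successively E ((a # P @ b # c # R1 @ t # R2') @ [a])"
    proof (rule successively_snocI)
      have "a # P @ b # c # R1 @ t # R2 = (a # P @ b # c # R1 @ t # R2') @ R3"
        by (simp add: R2)
      with prem(2) have "successively E ((a # P @ b # c # R1 @ t # R2') @ R3)"
        by (simp only:)
      then show "successively E (a # P @ b # c # R1 @ t # R2')"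
        by (simp only: successively_append_iff)
      show "E (last (a # P @ b # c # R1 @ t # R2')) a"
        using last sym[OF prem(4)] by simp
    qed
    ultimately show False
      using no_K4[of a P b "[]" c R1 t R2' "[]" "[]"] prem by simp
  qed
  obtain R1 t' R2 where R: "R = R1 @ t' # R2" and t': "t' = s \<or> t' = t" and R1: "s \<notin> set R1" "t \<notin> set R1"
    using split_list_first_prop[of R "\<lambda>r. r = s \<or> r = t"] assms(6) by blast
  show False
  proof (cases "t' = t")
    case True
    with crossing[of a P b R1 t R2 s] assms R R1 show False by auto
  next
    case False
    then have s: "t' = s" using t' by blast
    have "distinct (b # rev P @ a # c # R1 @ s # R2)"
      by (rule distinct_mset_mono[OF _ assms(1)]) (simp add: R s)
    moreover have "successively E (b # rev P @ a # c # R1 @ s # R2)"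
    proof -
      have "successively E (rev (a # P @ [b]))"
        unfolding successively_rev_E using assms(2) successively_split[of E "a # P" b "c # R"] by auto
      moreover have "successively E (a # c # R1 @ s # R2)"
        using assms(2,3) successively_split[of E "a # P @ [b]" c R] by (auto simp: R s)
      ultimately show ?thesis
        using successively_split[of E "b # rev P" a "c # R1 @ s # R2"] by simp
    qed
    ultimately show False
      using crossing[of b "rev P" a R1 s R2 t] assms R R1 False s successively_split[of E "a # P" b "c # R"]
      by auto
  qed
qed

definition nbrs :: "'a set \<Rightarrow> 'a \<Rightarrow> 'a set" where
  "nbrs X z = {y \<in> X. E z y}"

text \<open>Among the longest paths \<open>x\<^sub>0, x\<^sub>1, \<dots>\<close> take one with a chord \<open>x\<^sub>0 x\<^sub>i\<close>, \<open>i \<ge> 2\<close>, for the smallest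
  possible \<open>i\<close>. Reversing \<open>x\<^sub>0, \<dots>, x\<^sub>i\<^sub>-\<^sub>1\<close> gives another longest path, so both \<open>x\<^sub>0\<close> and \<open>x\<^sub>i\<^sub>-\<^sub>1\<close> have a
  neighbour beyond \<open>x\<^sub>i\<close>.\<close>
lemma exists_low_degree:
  assumes fin: "finite X" and ne: "X \<noteq> {}"
  shows "\<exists>z\<in>X. card (nbrs X z) \<le> 2"
proof (rule ccontr)
  assume "\<not> ?thesis"
  then have deg: "3 \<le> card (nbrs X z)" if "z \<in> X" for z
    using that by auto
  define is_path where "is_path xs \<longleftrightarrow> xs \<noteq> [] \<and> distinct xs \<and> set xs \<subseteq> X \<and> successively E xs" for xs
  have third: "\<exists>t\<in>nbrs X z. t \<noteq> p \<and> t \<noteq> q" if "z \<in> X" for z p q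
  proof (rule ccontr)
    assume "\<not> ?thesis"
    then have "nbrs X z \<subseteq> {p, q}" by blast
    then have "card (nbrs X z) \<le> card {p, q}" by (intro card_mono) auto
    also have "\<dots> \<le> 2" by (simp add: card_insert_if)
    finally show False using deg[OF that] by simp
  qed
  obtain x where "x \<in> X" using ne by blast
  then have "is_path [x]" by (simp add: is_path_def)
  moreover have "length xs < Suc (card X)" if "is_path xs" for xs
    using that fin by (metis is_path_def card_mono distinct_card less_Suc_eq_le)
  ultimately obtain L where L: "is_path L" and longest: "\<And>xs. is_path xs \<Longrightarrow> length xs \<le> length L"
    using ex_has_greatest_nat[of is_path "[x]" length "Suc (card X)"] by (metis less_imp_le_nat)
  define chord where "chord xs i \<longleftrightarrow> is_path xs \<and> length xs = length L \<and> 2 \<le> i \<and> i < length xs \<and> E (xs ! 0) (xs ! i)"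
    for xs and i :: nat
  have nbrs_on: "y \<in> set xs" if "is_path xs" "length xs = length L" "y \<in> nbrs X (hd xs)" for xs y
  proof (rule ccontr)
    assume "y \<notin> set xs"
    then have "is_path (y # xs)"
      using that sym by (auto simp: is_path_def nbrs_def successively_Cons)
    with longest[of "y # xs"] that show False by simp
  qed
  \<comment> \<open>Avoiding \<open>xs ! 1\<close> makes the index at least 2. The further exclusion
    of \<open>q\<close> is what the third neighbour is for: it forces an index other than the
    minimal one.\<close>
  have far: "\<exists>i. chord xs i \<and> xs ! i \<noteq> q" if xs: "is_path xs" "length xs = length L" for xs q
  proof -
    have "hd xs \<in> X" using xs by (auto simp: is_path_def)
    then obtain t where t: "t \<in> nbrs X (hd xs)" "t \<noteq> xs ! 1" "t \<noteq> q"
      using third[of "hd xs" "xs ! 1" q] by blast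
    then obtain i where i: "i < length xs" "xs ! i = t"
      using nbrs_on[OF xs] by (meson in_set_conv_nth)
    have hd0: "hd xs = xs ! 0" using xs by (simp add: is_path_def hd_conv_nth)
    have "i \<noteq> 0"
    proof
      assume "i = 0"
      with i t irrefl[of "xs ! 0"] show False by (simp add: nbrs_def hd0)
    qed
    moreover have "i \<noteq> 1"
      using i t by auto
    ultimately show ?thesis
      using i t xs by (intro exI[of _ i]) (auto simp: chord_def nbrs_def hd0)
  qed
  define P where "P i \<longleftrightarrow> (\<exists>xs. chord xs i)" for i
  define i where "i = (LEAST i. P i)"
  have "P i" unfolding i_def using far[OF L] by (metis LeastI P_def)
  then obtain xs where xs: "chord xs i" by (auto simp: P_def)
  have least: "i \<le> j" if "chord ys j" for ys j
    unfolding i_def using that by (intro Least_le) (auto simp: P_def)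
  have i: "2 \<le> i" "i < length xs" "E (xs ! 0) (xs ! i)" "is_path xs" "length xs = length L"
    using xs by (auto simp: chord_def)
  obtain a Q b where ab: "take i xs = a # Q @ [b]"
  proof -
    have "length (take i xs) \<ge> 2" using i by simp
    then obtain a S where S: "take i xs = a # S" "S \<noteq> []"
      by (cases "take i xs") (auto simp: Suc_le_eq)
    then show thesis using that[of a "butlast S" "last S"] by simp
  qed
  define c R where "c = xs ! i" and "R = drop (Suc i) xs"
  have "xs = take i xs @ c # R"
    using i by (simp add: c_def R_def id_take_nth_drop)
  then have eq: "xs = a # Q @ b # c # R" by (simp add: ab)
  have len: "i = Suc (Suc (length Q))"
    using ab i by (metis length_append length_take length_Cons list.size(3) min.absorb4 add_Suc_right add_0_right)
  have c: "c = xs ! i" by (simp add: c_def)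
  have ac: "E a c" using i(3) by (simp add: c[symmetric]) (simp add: eq)
  have path: "distinct (a # Q @ b # c # R)" "successively E (a # Q @ b # c # R)" "set (a # Q @ b # c # R) \<subseteq> X"
    using i(4) by (simp_all add: is_path_def eq)
  \<comment> \<open>Position \<open>i\<close> of \<open>ys\<close> carries \<open>c\<close>. A chord
    avoiding \<open>c\<close> has another index, which is larger by minimality and hence a position
    in \<open>R\<close>.\<close>
  have beyond: "\<exists>s\<in>set R. E (hd ys) s"
    if ys: "is_path ys" "ys = zs @ c # R" "length zs = i" for ys zs
  proof -
    have l: "length ys = length L" using ys i eq len by simp
    obtain j where j: "chord ys j" "ys ! j \<noteq> c" using far[OF ys(1) l] by blast
    then have "i \<le> j" using least by blast
    moreover have "j \<noteq> i" using j ys by auto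
    ultimately have "ys ! j = R ! (j - Suc i)" "j - Suc i < length R"
      using j ys by (auto simp: nth_append nth_Cons' chord_def)
    then have "ys ! j \<in> set R" by simp
    moreover have "hd ys = ys ! 0" using ys by (simp add: hd_conv_nth)
    ultimately show ?thesis using j by (auto simp: chord_def)
  qed
  obtain s where s: "s \<in> set R" "E a s"
    using beyond[of xs "a # Q @ [b]"] i(4) eq len by auto
  have "is_path (b # rev Q @ a # c # R)"
  proof -
    have "distinct (b # rev Q @ a # c # R)"
      by (rule distinct_mset_mono[OF _ path(1)]) simp
    moreover have "successively E (rev (a # Q @ [b]))"
      unfolding successively_rev_E using path(2) successively_split[of E "a # Q" b "c # R"] by auto
    moreover have "successively E (a # c # R)"
      using path(2) ac successively_split[of E "a # Q @ [b]" c R] by auto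
    ultimately show ?thesis
      using successively_split[of E "b # rev Q" a "c # R"] path(3) by (auto simp: is_path_def)
  qed
  then have "\<exists>t\<in>set R. E (hd (b # rev Q @ a # c # R)) t"
    by (rule beyond[of _ "b # rev Q @ [a]"]) (simp_all add: len)
  then obtain t where t: "t \<in> set R" "E b t"
    by auto
  show False
    using long_path_crossing[OF path(1,2) ac s(2) t(2) s(1) t(1)] .
qed

section \<open>Noncrossing orders (one-page book embeddings): rotating and gluing\<close>

definition noncrossing :: "'a list \<Rightarrow> bool" where
  "noncrossing xs \<longleftrightarrow> (\<forall>a b c d. subseq [a, b, c, d] xs \<longrightarrow> \<not> (E a c \<and> E b d))"

lemma noncrossing_subseq: "noncrossing ys \<Longrightarrow> subseq xs ys \<Longrightarrow> noncrossing xs"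
  unfolding noncrossing_def using subseq_order.trans by blast

lemma noncrossingD: "noncrossing xs \<Longrightarrow> subseq [a, b, c, d] xs \<Longrightarrow> E a c \<Longrightarrow> \<not> E b d"
  unfolding noncrossing_def by blast

text \<open>Crossing depends only on the cyclic order: a rotation of four points keeps the pairs
  \<open>ac\<close> and \<open>bd\<close> alternating.\<close>

lemma noncrossing_rotate:
  assumes "noncrossing (xs @ ys)"
  shows "noncrossing (ys @ xs)"
  unfolding noncrossing_def
proof (intro allI impI notI)
  fix a b c d
  assume sub: "subseq [a, b, c, d] (ys @ xs)" and cross: "E a c \<and> E b d"
  obtain l1 l2 where l: "[a, b, c, d] = l1 @ l2" "subseq l1 ys" "subseq l2 xs"
    using sub by (auto simp: subseq_append_iff)
  then have rot: "subseq (l2 @ l1) (xs @ ys)" by (intro list_emb_append_mono)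
  have cross': "E a c" "E b d" "E c a" "E d b" using cross sym by blast+
  consider "l1 = []" "l2 = [a, b, c, d]" | "l1 = [a]" "l2 = [b, c, d]" | "l1 = [a, b]" "l2 = [c, d]"
    | "l1 = [a, b, c]" "l2 = [d]" | "l1 = [a, b, c, d]" "l2 = []"
    using l(1) by (rule append_eq_four_cases)
  then show False
  proof cases
    case 1 then show ?thesis using noncrossingD[OF assms, of a b c d] rot cross' by simp
  next
    case 2 then show ?thesis using noncrossingD[OF assms, of b c d a] rot cross' by simp
  next
    case 3 then show ?thesis using noncrossingD[OF assms, of c d a b] rot cross' by simp
  next
    case 4 then show ?thesis using noncrossingD[OF assms, of d a b c] rot cross' by simp
  next
    case 5 then show ?thesis using noncrossingD[OF assms, of a b c d] rot cross' by simp
  qed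
qed

lemma noncrossing_starting_at:
  assumes "noncrossing xs" "distinct xs" "x \<in> set xs"
  obtains ys where "noncrossing (x # ys)" "distinct (x # ys)" "set (x # ys) = set xs"
proof -
  obtain as bs where xs: "xs = as @ x # bs" using assms(3) by (meson split_list)
  have "noncrossing (x # bs @ as)" using noncrossing_rotate[of as "x # bs"] assms xs by simp
  with assms xs that[of "bs @ as"] show thesis by auto
qed

lemma noncrossing_ending_at:
  assumes "noncrossing xs" "distinct xs" "x \<in> set xs"
  obtains ys where "noncrossing (ys @ [x])" "distinct (ys @ [x])" "set (ys @ [x]) = set xs"
proof -
  obtain ys where "noncrossing (x # ys)" "distinct (x # ys)" "set (x # ys) = set xs"
    using noncrossing_starting_at assms by blast
  with that[of ys] noncrossing_rotate[of "[x]" ys] show thesis by auto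
qed

text \<open>A crossing spread over both blocks has an edge between them, which must be
  \<open>uv\<close>. That edge joins the extremes of the order, whereas an edge of a crossing always
  has a point beyond one of its ends.\<close>

lemma noncrossing_append:
  assumes nc: "noncrossing (u # as)" "noncrossing (bs @ [v])"
    and dist: "distinct (u # as @ bs @ [v])"
    and sep: "\<And>x y. x \<in> set (u # as) \<Longrightarrow> y \<in> set (bs @ [v]) \<Longrightarrow> E x y \<Longrightarrow> x = u \<and> y = v"
  shows "noncrossing (u # as @ bs @ [v])"
  unfolding noncrossing_def
proof (intro allI impI notI)
  fix a b c d
  assume sub: "subseq [a, b, c, d] (u # as @ bs @ [v])" and cross: "E a c \<and> E b d"
  obtain l1 l2 where l: "[a, b, c, d] = l1 @ l2" "subseq l1 (u # as)" "subseq l2 (bs @ [v])"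
    using sub subseq_append_iff[of "[a, b, c, d]" "u # as" "bs @ [v]"] by auto
  have mem: "set l1 \<subseteq> set (u # as)" "set l2 \<subseteq> set (bs @ [v])"
    using l set_subseq_subset by blast+
  have dv: "distinct (bs @ [v])" and du: "distinct (u # as)" using dist by auto
  consider "l1 = []" | "l1 = [a]" "l2 = [b, c, d]" | "l1 = [a, b]" "l2 = [c, d]"
    | "l1 = [a, b, c]" "l2 = [d]" | "l2 = []"
    using l(1) by (rule append_eq_four_cases) blast+
  then show False
  proof cases
    case 1 then show ?thesis using l noncrossingD[OF nc(2)] cross by auto
  next
    case 2
    then have "a \<in> set (u # as)" "c \<in> set (bs @ [v])" using mem by auto
    then have "c = v" using sep cross by blast
    then show ?thesis using subseq_snoc_last[of "[b]" c "[]" d] l(3) 2 dv by auto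
  next
    case 3
    then have "a \<in> set (u # as)" "c \<in> set (bs @ [v])" using mem by auto
    then have "c = v" using sep cross by blast
    then show ?thesis using subseq_snoc_last[of "[]" c "[]" d] l(3) 3 dv by auto
  next
    case 4
    then have "b \<in> set (u # as)" "d \<in> set (bs @ [v])" using mem by auto
    then have "b = u" using sep cross by blast
    then show ?thesis using subseq_Cons_hd[of a "[]" b "[c]"] l(2) 4 du by auto
  next
    case 5 then show ?thesis using l noncrossingD[OF nc(1)] cross by auto
  qed
qed

lemma noncrossing_join:
  assumes nc: "noncrossing (u # as @ [w])" "noncrossing (w # bs @ [v])"
    and dist: "distinct (u # as @ w # bs @ [v])"
    and sep: "\<And>x y. x \<in> set (u # as) \<Longrightarrow> y \<in> set (bs @ [v]) \<Longrightarrow> E x y \<Longrightarrow> x = u \<and> y = v"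
  shows "noncrossing (u # as @ w # bs @ [v])"
  unfolding noncrossing_def
proof (intro allI impI notI)
  fix a b c d
  assume sub: "subseq [a, b, c, d] (u # as @ w # bs @ [v])" and cross: "E a c \<and> E b d"
  have ncu: "noncrossing (u # as)"
    using nc(1) by (rule noncrossing_subseq) (metis append_Cons subseq_order.refl subseq_rev_drop_many)
  have ncv: "noncrossing (bs @ [v])"
    using nc(2) by (rule noncrossing_subseq) (metis subseq_order.refl list_emb_Cons)
  have dv: "distinct (bs @ [v])" and du: "distinct (u # as)" using dist by auto
  obtain l1 l2 where l: "[a, b, c, d] = l1 @ l2" "subseq l1 (u # as)" "subseq l2 (w # bs @ [v])"
    using sub subseq_append_iff[of "[a, b, c, d]" "u # as" "w # bs @ [v]"] by auto
  show False
  proof (cases "subseq l2 (bs @ [v])")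
    case True
    then have "subseq (l1 @ l2) ((u # as) @ bs @ [v])" using l(2) by (intro list_emb_append_mono)
    moreover have "noncrossing (u # as @ bs @ [v])"
      using noncrossing_append[OF ncu ncv _ sep] dist by auto
    ultimately show ?thesis using noncrossingD[of "u # as @ bs @ [v]" a b c d] cross l(1) by simp
  next
    case False
    then obtain l2' where l2: "l2 = w # l2'" "subseq l2' (bs @ [v])"
      using l(3) by (cases l2) (auto split: if_splits)
    have mem: "set l1 \<subseteq> set (u # as)" "set l2' \<subseteq> set (bs @ [v])"
      using l l2 set_subseq_subset by blast+
    \<comment> \<open>In the two mixed cases \<open>w\<close> is \<open>b\<close> or
      \<open>c\<close>, and the edge of the crossing that does not end at \<open>w\<close> jumps
      over it, so \<open>sep\<close> makes it \<open>uv\<close>.\<close>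
    consider "l1 = []" | "l1 = [a]" "l2' = [c, d]" | "l1 = [a, b]" "l2' = [d]" | "l2' = []"
      using l(1) unfolding l2(1) by (rule append_eq_four_cases) blast+
    then show ?thesis
    proof cases
      case 1 then show ?thesis using l noncrossingD[OF nc(2)] cross by auto
    next
      case 2
      then have "a \<in> set (u # as)" "c \<in> set (bs @ [v])" using mem by auto
    then have "c = v" using sep cross by blast
      then show ?thesis using subseq_snoc_last[of "[]" c "[]" d] l2(2) 2 dv by auto
    next
      case 3
      then have "b \<in> set (u # as)" "d \<in> set (bs @ [v])" using mem by auto
    then have "b = u" using sep cross by blast
      then show ?thesis using subseq_Cons_hd[of a "[]" b "[]"] l(2) 3 du by auto
    next
      case 4
      then have "subseq [a, b, c, d] ((u # as) @ [w])"
        unfolding l(1) l2(1) using l(2) by (intro list_emb_append_mono) simp_all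
      then show ?thesis using noncrossingD[OF nc(1), of a b c d] cross by simp
    qed
  qed
qed

text \<open>Fix a path from \<open>u\<close> to \<open>v\<close>. An ear leaves it at \<open>u\<close> and returns to it later; the last vertex \<open>w\<close>
  at which an ear returns is the cut vertex: an ear jumping over \<open>w\<close> would either extend the ear to
  \<open>w\<close> or cross it.\<close>
lemma exists_cut_vertex:
  assumes ne: "u \<noteq> v"
    and outer: "W \<noteq> []" "distinct W" "set W \<inter> X = {}" "successively E (v # W @ [u])"
  defines "R \<equiv> \<lambda>x y. E x y \<and> x \<in> X \<and> y \<in> X \<and> {x, y} \<noteq> {u, v}"
  assumes reach: "R\<^sup>*\<^sup>* u v"
  obtains P1 w P2 where "distinct (u # P1 @ w # P2 @ [v])" "successively R (u # P1 @ w # P2 @ [v])"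
    "\<not> (\<lambda>x y. R x y \<and> x \<noteq> w \<and> y \<noteq> w)\<^sup>*\<^sup>* u v"
proof -
  have RE: "successively R xs \<Longrightarrow> successively E xs" for xs
    by (erule successively_mono) (simp add: R_def)
  have RX: "R x y \<Longrightarrow> x \<in> X \<and> y \<in> X" for x y
    by (simp add: R_def)
  have nR: "\<not> R u v" by (simp add: R_def)
  obtain p where p: "distinct (u # p)" "successively R (u # p)" "last (u # p) = v"
    using path_of_rtranclp[OF reach] by blast
  then have "p \<noteq> []" using ne by auto
  then have "p = butlast p @ [v]" using p by (metis append_butlast_last_id last_ConsR)
  then obtain P where pP: "p = P @ [v]" by blast
  have "P \<noteq> []" using p nR by (auto simp: pP)
  have path: "distinct (u # P @ [v])" "successively R (u # P @ [v])" using p by (simp_all add: pP)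
  have PX: "set (u # P @ [v]) \<subseteq> X"
  proof -
    have "u \<in> X" using path \<open>P \<noteq> []\<close> by (cases P) (auto dest: RX)
    moreover have "set (P @ [v]) \<subseteq> X"
      using successively_predecessor[OF path(2)] RX by blast
    ultimately show ?thesis by simp
  qed
  define ear where "ear y \<longleftrightarrow> (\<exists>I. distinct I \<and> set I \<subseteq> X - set (u # P @ [v]) \<and> successively R (u # I @ [y]))" for y
  have "ear (hd P)"
    unfolding ear_def using path(2) \<open>P \<noteq> []\<close> by (intro exI[of _ "[]"]) (cases P; simp)
  then have ex: "\<exists>y\<in>set P. ear y" using \<open>P \<noteq> []\<close> by (meson hd_in_set)
  \<comment> \<open>An ear to \<open>v\<close>, the path and \<open>W\<close> would form a theta.
    The ear has an inner vertex because \<open>R\<close> omits the edge \<open>uv\<close>.\<close>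
  have not_v: "\<not> ear v"
  proof
    assume "ear v"
    then obtain I where I: "distinct I" "set I \<subseteq> X - set (u # P @ [v])" "successively R (u # I @ [v])"
      by (auto simp: ear_def)
    then have "I \<noteq> []" using nR by auto
    moreover have "distinct (u # v # P @ I @ rev W)"
      using path(1) I(1,2) outer PX by auto
    moreover have "successively E (rev (v # W @ [u]))"
      unfolding successively_rev_E using outer by simp
    ultimately show False
      using no_theta[of u v P I "rev W"] \<open>P \<noteq> []\<close> outer RE[OF path(2)] RE[OF I(3)] by simp
  qed
  obtain P1 w P2 where P: "P = P1 @ w # P2" and w: "ear w" and last: "\<forall>y\<in>set P2. \<not> ear y"
    using split_list_last_prop[OF ex] by blast
  have "\<not> (\<lambda>x y. R x y \<and> x \<noteq> w \<and> y \<noteq> w)\<^sup>*\<^sup>* u v" (is "\<not> ?S\<^sup>*\<^sup>* u v")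
  proof
    assume "?S\<^sup>*\<^sup>* u v"
    then obtain r where r: "distinct (u # r)" "successively ?S (u # r)" "last (u # r) = v"
      using path_of_rtranclp[of ?S u v] by blast
    have dP: "distinct (u # P1 @ w # P2 @ [v])" using path(1) by (simp add: P)
    \<comment> \<open>From a walk avoiding \<open>w\<close>, cut out the piece between its last
      visit to the part before \<open>w\<close> and its next visit to the part after
      \<open>w\<close>. This detour \<open>e\<close> meets the fixed path only at its ends
      \<open>x\<close> and \<open>y\<close>.\<close>
    have "\<exists>z\<in>set (u # r). z \<in> insert u (set P1)" by simp
    then obtain r1 x r2 where x: "u # r = r1 @ x # r2" "x \<in> insert u (set P1)" "\<forall>z\<in>set r2. z \<notin> insert u (set P1)"
      using split_list_last_prop[of "u # r" "\<lambda>z. z \<in> insert u (set P1)"] by blast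
    have "r2 \<noteq> []"
    proof
      assume "r2 = []"
      then have "x = v" using x(1) r(3) by simp
      then show False using x(2) dP by auto
    qed
    then have "last r2 = v" using x(1) r(3) by simp
    then have "v \<in> set r2" using \<open>r2 \<noteq> []\<close> last_in_set by blast
    then have "\<exists>z\<in>set r2. z \<in> insert v (set P2)" by auto
    then obtain e y r3 where y: "r2 = e @ y # r3" "y \<in> insert v (set P2)" "\<forall>z\<in>set e. z \<notin> insert v (set P2)"
      using split_list_first_prop[of r2 "\<lambda>z. z \<in> insert v (set P2)"] by blast
    have "successively ?S (r1 @ x # e @ y # r3)" using r(2) x(1) y(1) by simp
    then have "successively ?S (x # e @ y # r3)"
      using successively_split[of ?S r1 x "e @ y # r3"] by blast
    then have Se: "successively ?S (x # e @ [y])"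
      using successively_split[of ?S "x # e" y r3] by simp
    then have Re: "successively R (x # e @ [y])"
      by (rule successively_mono) simp
    have e: "distinct e" "set e \<subseteq> X - set (u # P @ [v])"
    proof -
      show "distinct e" using r(1) unfolding x(1) y(1) by auto
      have "z \<in> X - {w}" if "z \<in> set e" for z
        using successively_predecessor[OF Se, of z] that by (auto simp: R_def)
      then show "set e \<subseteq> X - set (u # P @ [v])" using x(3) y(1,3) by (auto simp: P)
    qed
    have not_ear: "\<not> ear y" using y(2) last not_v by blast
    have "x \<noteq> u"
      using not_ear e Re unfolding ear_def by blast
    then have "x \<in> set P1" using x(2) by simp
    then obtain P11 P12 where P1: "P1 = P11 @ x # P12" by (meson split_list)
    obtain I where I: "distinct I" "set I \<subseteq> X - set (u # P @ [v])" "successively R (u # I @ [w])"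
      using w by (auto simp: ear_def)
    show False
    proof (cases "set I \<inter> set e = {}")
      case False
      \<comment> \<open>Following the ear up to its first vertex on the detour, and then the detour,
        gives an ear to \<open>y\<close>.\<close>
      then have "\<exists>z\<in>set I. z \<in> set e" by blast
      then obtain I1 z I2 where z: "I = I1 @ z # I2" "z \<in> set e" "\<forall>t\<in>set I1. t \<notin> set e"
        using split_list_first_prop[of I "\<lambda>z. z \<in> set e"] by blast
      then obtain e1 e2 where e12: "e = e1 @ z # e2" by (meson split_list)
      have "successively R (u # I1 @ [z])"
        using I(3) successively_split[of R "u # I1" z "I2 @ [w]"] by (simp add: z)
      moreover have "successively R (z # e2 @ [y])"
        using Re successively_split[of R "x # e1" z "e2 @ [y]"] by (simp add: e12)
      ultimately have "successively R (u # (I1 @ z # e2) @ [y])"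
        using successively_split[of R "u # I1" z "e2 @ [y]"] by simp
      moreover have "distinct (I1 @ z # e2)" "set (I1 @ z # e2) \<subseteq> X - set (u # P @ [v])"
        using I(1,2) e z e12 by auto
      ultimately show False using not_ear unfolding ear_def by blast
    next
      case True
      \<comment> \<open>On the cycle made of the path and \<open>W\<close> the ends appear as
        \<open>u\<close>, \<open>x\<close>, \<open>w\<close>, \<open>y\<close>, so the ear from
        \<open>u\<close> to \<open>w\<close> and the detour from \<open>x\<close> to
        \<open>y\<close> are crossing chord paths.\<close>
      have "y \<in> set (P2 @ [v])" using y(2) by auto
      then obtain P21 P22 where P2: "P2 @ [v] = P21 @ y # P22" by (meson split_list)
      have cycle: "u # P11 @ x # P12 @ w # P21 @ y # P22 = u # P @ [v]"
        using P2 by (simp add: P P1)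
      have "distinct ((u # P @ [v]) @ W @ I @ e)"
        using path(1) outer(2,3) I(1,2) e True PX by auto
      then have "distinct (u # P11 @ x # P12 @ w # P21 @ y # (P22 @ W) @ I @ e)"
        unfolding cycle[symmetric] by simp
      moreover have "successively E (u # P11 @ x # P12 @ w # P21 @ y # (P22 @ W) @ [u])"
      proof -
        have "successively E ((u # P) @ v # W @ [u])"
          using RE[OF path(2)] outer(4) successively_split[of E "u # P" v "W @ [u]"] by simp
        then have "successively E ((u # P @ [v]) @ W @ [u])" by simp
        then show ?thesis unfolding cycle[symmetric] by simp
      qed
      ultimately show False
        using no_K4 RE[OF I(3)] RE[OF Re] by blast
    qed
  qed
  then show thesis
    by (rule that[rotated 2]) (use path P in simp_all)
qed

text \<open>\<open>W\<close> is the return path that makes both ends prescribable.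
  \<open>smaller\<close> orders sets with free ends; it serves when at most the edge
  \<open>uv\<close> links the two ends inside \<open>X\<close>, where each side is rotated to put
  its end outermost.\<close>

lemma noncrossing_between:
  assumes smaller: "\<And>Y. finite Y \<Longrightarrow> card Y \<le> n \<Longrightarrow> \<exists>ys. distinct ys \<and> set ys = Y \<and> noncrossing ys"
    and "finite X" "card X \<le> n" "u \<in> X" "v \<in> X" "u \<noteq> v"
    and "W \<noteq> []" "distinct W" "set W \<inter> X = {}" "successively E (v # W @ [u])"
  shows "\<exists>ys. distinct (u # ys @ [v]) \<and> set (u # ys @ [v]) = X \<and> noncrossing (u # ys @ [v])"
  using assms(2-)
proof (induction "card X" arbitrary: X u v W rule: less_induct)
  case less
  note fin = less.prems(1) and uv = less.prems(3-5) and outer = less.prems(6-9)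
  define R where "R = (\<lambda>x y. E x y \<and> x \<in> X \<and> y \<in> X \<and> {x, y} \<noteq> {u, v})"
  have RX: "R x y \<Longrightarrow> x \<in> X \<and> y \<in> X" for x y
    by (simp add: R_def)
  have RE: "successively R xs \<Longrightarrow> successively E xs" for xs
    by (erule successively_mono) (simp add: R_def)
  show ?case
  proof (cases "R\<^sup>*\<^sup>* u v")
    case False
    define A where "A = {x. R\<^sup>*\<^sup>* u x}"
    have A: "A \<subseteq> X" "u \<in> A" "v \<notin> A"
    proof -
      show "A \<subseteq> X" using uv by (auto simp: A_def elim: rtranclp.cases dest: RX)
    qed (use False in \<open>auto simp: A_def\<close>)
    then have "card A \<le> n" "card (X - A) \<le> n" "finite A"
      using less.prems(1,2) by (auto intro: order_trans[OF card_mono] finite_subset)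
    then obtain as0 bs0 where "distinct as0" "set as0 = A" "noncrossing as0"
      and "distinct bs0" "set bs0 = X - A" "noncrossing bs0"
      using smaller[of A] smaller[of "X - A"] fin by auto
    with A uv obtain as bs where as: "distinct (u # as)" "set (u # as) = A" "noncrossing (u # as)"
      and bs: "distinct (bs @ [v])" "set (bs @ [v]) = X - A" "noncrossing (bs @ [v])"
      using noncrossing_starting_at[of as0 u] noncrossing_ending_at[of bs0 v] by (metis Diff_iff)
    have dist: "distinct (u # as @ bs @ [v])"
    proof -
      have "set (u # as) \<inter> set (bs @ [v]) = {}" using as bs by blast
      then have "distinct ((u # as) @ bs @ [v])" using as(1) bs(1) by (simp only: distinct_append)
      then show ?thesis by simp
    qed
    have "noncrossing (u # as @ bs @ [v])"
    proof (rule noncrossing_append[OF as(3) bs(3) dist])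
      fix x y assume xy: "x \<in> set (u # as)" "y \<in> set (bs @ [v])" "E x y"
      then have "x \<in> A" "y \<in> X" "y \<notin> A" using as bs by blast+
      then have "\<not> R x y" by (auto simp: A_def intro: rtranclp.rtrancl_into_rtrancl)
      with xy(3) \<open>x \<in> A\<close> \<open>y \<in> X\<close> \<open>y \<notin> A\<close> A show "x = u \<and> y = v"
        by (auto simp: R_def doubleton_eq_iff)
    qed
    moreover have "set (u # as @ bs @ [v]) = X"
      using as(2) bs(2) A by auto
    ultimately show ?thesis using dist by (intro exI[of _ "as @ bs"]) simp
  next
    case True
    obtain P1 w P2 where path: "distinct (u # P1 @ w # P2 @ [v])" "successively R (u # P1 @ w # P2 @ [v])"
      and cut: "\<not> (\<lambda>x y. R x y \<and> x \<noteq> w \<and> y \<noteq> w)\<^sup>*\<^sup>* u v"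
      using exists_cut_vertex[of u v W X thesis] uv outer True unfolding R_def by blast
    define S where "S = (\<lambda>x y. R x y \<and> x \<noteq> w \<and> y \<noteq> w)"
    \<comment> \<open>Vertices that neither end reaches go into \<open>B\<close> too: a piece needs
      no connectivity, only a return path between its ends.\<close>
    define A B where "A = {x. S\<^sup>*\<^sup>* u x}" and "B = X - insert w A"
    have PX: "set (P1 @ w # P2 @ [v]) \<subseteq> X"
      using successively_predecessor[OF path(2)] RX by blast
    have "A \<subseteq> X" using uv by (auto simp: A_def S_def elim: rtranclp.cases dest: RX)
    moreover have "w \<notin> A" using path(1) by (auto simp: A_def S_def elim: rtranclp.cases)
    moreover have "u \<in> A" by (simp add: A_def)
    moreover have "v \<notin> A" using cut by (simp add: A_def S_def)
    ultimately have A: "A \<subseteq> X" "w \<notin> A" "u \<in> A" "v \<notin> A" .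
    have w: "w \<in> X" "w \<noteq> u" "w \<noteq> v" using PX path(1) by auto
    have to_S: "successively R xs \<Longrightarrow> w \<notin> set xs \<Longrightarrow> successively S xs" for xs
      by (erule successively_mono) (auto simp: S_def)
    have "successively R (u # P1)"
      using path(2) successively_append_iff[of R "u # P1" "w # P2 @ [v]"] by simp
    then have P1A: "set P1 \<subseteq> A"
      using successively_rtranclp[OF to_S, of u P1] path(1) by (auto simp: A_def)
    have "successively R (w # P2 @ [v])"
      using path(2) successively_split[of R "u # P1" w "P2 @ [v]"] by simp
    then have "successively R (P2 @ [v])" by (simp add: successively_Cons)
    then have SP2: "successively S (P2 @ [v])" using path(1) by (intro to_S) auto
    have P2B: "set P2 \<subseteq> B"
    proof
      fix z assume z: "z \<in> set P2"
      then obtain q1 q2 where "P2 = q1 @ z # q2" by (meson split_list)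
      then have "successively S (z # q2 @ [v])"
        using SP2 successively_split[of S q1 z "q2 @ [v]"] by simp
      then have "S\<^sup>*\<^sup>* z v" using successively_rtranclp[of S z "q2 @ [v]" v] by simp
      then have "z \<notin> A" using A(4) by (auto simp: A_def dest: rtranclp_trans)
      then show "z \<in> B" using z PX path(1) by (auto simp: B_def)
    qed
    have path_E: "successively E (u # P1 @ [w])" "successively E (w # P2 @ [v])"
      using RE[OF path(2)] successively_split[of E "u # P1" w "P2 @ [v]"] by simp_all
    have "\<exists>as. distinct (u # as @ [w]) \<and> set (u # as @ [w]) = insert w A \<and> noncrossing (u # as @ [w])"
    \<comment> \<open>The left piece returns from \<open>w\<close> to \<open>u\<close> through the
      other half of the path and the old \<open>W\<close>; the right piece does so
      symmetrically.\<close>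
    proof (rule less.hyps[where W = "P2 @ v # W"])
      show "card (insert w A) < card X"
        using A w uv fin by (intro psubset_card_mono) auto
      then show "card (insert w A) \<le> n" using less.prems(2) by simp
      show "finite (insert w A)" using A fin finite_subset by auto
      show "distinct (P2 @ v # W)" using path(1) outer PX by auto
      show "set (P2 @ v # W) \<inter> insert w A = {}"
        using P2B A w outer by (auto simp: B_def)
      show "successively E (w # (P2 @ v # W) @ [u])"
        using path_E(2) outer(4) successively_split[of E "w # P2" v "W @ [u]"] by simp
    qed (use A w in auto)
    then obtain as where as: "distinct (u # as @ [w])" "set (u # as @ [w]) = insert w A" "noncrossing (u # as @ [w])"
      by blast
    have "\<exists>bs. distinct (w # bs @ [v]) \<and> set (w # bs @ [v]) = insert w B \<and> noncrossing (w # bs @ [v])"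
    proof (rule less.hyps[where W = "W @ u # P1"])
      show "card (insert w B) < card X"
        using A w uv fin by (intro psubset_card_mono) (auto simp: B_def)
      then show "card (insert w B) \<le> n" using less.prems(2) by simp
      show "finite (insert w B)" using fin by (simp add: B_def)
      show "distinct (W @ u # P1)" using path(1) outer PX uv by auto
      show "set (W @ u # P1) \<inter> insert w B = {}"
        using P1A A w outer by (auto simp: B_def)
      show "successively E (v # (W @ u # P1) @ [w])"
        using path_E(1) outer(4) successively_split[of E "v # W" u "P1 @ [w]"] by simp
    qed (use A w uv in \<open>auto simp: B_def\<close>)
    then obtain bs where bs: "distinct (w # bs @ [v])" "set (w # bs @ [v]) = insert w B" "noncrossing (w # bs @ [v])"
      by blast
    have sets: "set (u # as) = A" "set (bs @ [v]) = B"
      using as(1,2) bs(1,2) A w by (auto simp: B_def)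
    have dist: "distinct (u # as @ w # bs @ [v])"
    proof -
      have "set (u # as) \<inter> set (w # bs @ [v]) = {}" using sets bs(2) A by (auto simp: B_def)
      then have "distinct ((u # as) @ w # bs @ [v])"
        using as(1) bs(1) unfolding distinct_append by auto
      then show ?thesis by simp
    qed
    have "noncrossing (u # as @ w # bs @ [v])"
    proof (rule noncrossing_join[OF as(3) bs(3) dist])
      fix x y assume xy: "x \<in> set (u # as)" "y \<in> set (bs @ [v])" "E x y"
      then have "x \<in> A" "y \<in> B" using sets by blast+
      then have "\<not> S x y" by (auto simp: A_def B_def intro: rtranclp.rtrancl_into_rtrancl)
      with xy(3) \<open>x \<in> A\<close> \<open>y \<in> B\<close> A show "x = u \<and> y = v"
        by (auto simp: S_def R_def B_def doubleton_eq_iff)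
    qed
    moreover have "set (u # as @ w # bs @ [v]) = X"
      using sets A w by (auto simp: B_def)
    ultimately show ?thesis using dist by (intro exI[of _ "as @ w # bs"]) simp
  qed
qed

text \<open>A vertex \<open>z\<close> placed first is in a crossing only through an edge to a vertex
  strictly inside the remaining order. So its neighbours must be the extremes of that order, which
  is why degree two is the limit. For two neighbours the return path is \<open>[z]\<close>.\<close>

lemma exists_noncrossing_list:
  assumes "finite X"
  shows "\<exists>xs. distinct xs \<and> set xs = X \<and> noncrossing xs"
  using assms
proof (induction "card X" arbitrary: X rule: less_induct)
  case less
  show ?case
  proof (cases "X = {}")
    case True
    then show ?thesis by (intro exI[of _ "[]"]) (simp add: noncrossing_def)
  next
    case False
    then obtain z where z: "z \<in> X" "card (nbrs X z) \<le> 2"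
      using exists_low_degree less.prems by blast
    let ?Y = "X - {z}"
    have Y: "finite ?Y" "card ?Y < card X"
      using card_Diff1_less[OF less.prems z(1)] less.prems by auto
    have smaller: "\<exists>ys. distinct ys \<and> set ys = Z \<and> noncrossing ys" if "finite Z" "card Z \<le> card ?Y" for Z
      using less.hyps[of Z] that Y by simp
    have nbrs_Y: "nbrs X z \<subseteq> ?Y" using irrefl by (auto simp: nbrs_def)
    have cons: "noncrossing (z # ys)"
      if ys: "noncrossing ys" "set ys = ?Y" and nbr: "\<And>b c d. subseq [b, c, d] ys \<Longrightarrow> c \<notin> nbrs X z" for ys
      unfolding noncrossing_def
    proof (intro allI impI notI)
      fix a b c d assume sub: "subseq [a, b, c, d] (z # ys)" and cross: "E a c \<and> E b d"
      show False
      proof (cases "a = z")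
        case True
        then have s: "subseq [b, c, d] ys" using sub by simp
        then have "c \<in> X" using set_subseq_subset[OF s] ys(2) by auto
        then show ?thesis using nbr[OF s] cross True by (auto simp: nbrs_def)
      next
        case False
        then show ?thesis using sub cross noncrossingD[OF ys(1)] by auto
      qed
    qed
    have insert_z: ?thesis if "noncrossing (z # ys)" "distinct ys" "set ys = ?Y" for ys
      by (intro exI[of _ "z # ys"] conjI) (use that z in auto)
    consider "nbrs X z = {}" | u where "nbrs X z = {u}" | u v where "nbrs X z = {u, v}" "u \<noteq> v"
    proof -
      have "card (nbrs X z) = 0 \<or> card (nbrs X z) = 1 \<or> card (nbrs X z) = 2" using z by linarith
      moreover have "finite (nbrs X z)" using less.prems by (simp add: nbrs_def)
      ultimately show thesis using that by (auto simp: card_1_singleton_iff card_2_iff)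
    qed
    then show ?thesis
    proof cases
      case 1
      obtain ys where ys: "distinct ys" "set ys = ?Y" "noncrossing ys" using smaller Y by blast
      moreover have "noncrossing (z # ys)" by (intro cons ys) (simp add: 1)
      ultimately show ?thesis using insert_z by blast
    next
      case 2
      obtain ys0 where ys0: "distinct ys0" "set ys0 = ?Y" "noncrossing ys0" using smaller Y by blast
      have "u \<in> set ys0" using 2 nbrs_Y ys0 by auto
      obtain ys where ys: "noncrossing (u # ys)" "distinct (u # ys)" "set (u # ys) = ?Y"
        by (rule noncrossing_starting_at[OF ys0(3,1) \<open>u \<in> set ys0\<close>, unfolded ys0(2)])
      have ne: "c \<noteq> u" if "subseq [b, c, d] (u # ys)" for b c d
        using subseq_Cons_hd[of b "[]" c "[d]" u ys] that ys by simp
      have "noncrossing (z # u # ys)"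
        using ne by (intro cons[OF ys(1,3)]) (unfold 2, blast)
      then show ?thesis by (rule insert_z[OF _ ys(2,3)])
    next
      case 3
      have "u \<in> nbrs X z" "v \<in> nbrs X z" using 3 by auto
      then have "E z u" "E z v" "u \<in> ?Y" "v \<in> ?Y" using nbrs_Y by (auto simp: nbrs_def)
      moreover have "E v z" using \<open>E z v\<close> by (rule sym)
      ultimately have "\<exists>ys. distinct (u # ys @ [v]) \<and> set (u # ys @ [v]) = ?Y \<and> noncrossing (u # ys @ [v])"
        by (intro noncrossing_between[where n = "card ?Y" and W = "[z]"] smaller) (use Y 3 in auto)
      then obtain ys where ys: "distinct (u # ys @ [v])" "set (u # ys @ [v]) = ?Y" "noncrossing (u # ys @ [v])"
        by blast
      have ne: "c \<noteq> u" "c \<noteq> v" if "subseq [b, c, d] (u # ys @ [v])" for b c d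
        using subseq_Cons_hd[of b "[]" c "[d]" u "ys @ [v]"] subseq_snoc_last[of "[b]" c "[]" d "u # ys" v] that ys
        by simp_all
      have "noncrossing (z # u # ys @ [v])"
        using ne by (intro cons[OF ys(3,2)]) (unfold 3(1), blast)
      then show ?thesis by (rule insert_z[OF _ ys(1,2)])
    qed
  qed
qed

text \<open>Take for \<open>w\<close> the last inner neighbour of \<open>u\<close>: an edge from
  \<open>as\<close> over \<open>w\<close> would cross \<open>uw\<close>, and \<open>u\<close> has no
  later neighbour except possibly \<open>v\<close>. Without inner neighbours of \<open>u\<close> the
  first inner vertex serves.\<close>

lemma noncrossing_apex:
  assumes nc: "noncrossing (u # ys @ [v])" and ne: "ys \<noteq> []"
  obtains as w bs where "ys = as @ w # bs"
    "\<forall>x\<in>set (u # as). \<forall>y\<in>set (bs @ [v]). E x y \<longrightarrow> x = u \<and> y = v"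
proof (cases "\<exists>y\<in>set ys. E u y")
  case True
  then obtain as w bs where w: "ys = as @ w # bs" "E u w" "\<forall>y\<in>set bs. \<not> E u y"
    using split_list_last_prop[of ys "E u"] by blast
  have "\<not> E x y" if "x \<in> set as" "y \<in> set (bs @ [v])" for x y
  proof -
    have "subseq ([u] @ [x] @ [w] @ [y]) ([u] @ as @ [w] @ bs @ [v])"
      using that by (intro list_emb_append_mono) (auto simp: subseq_singleton_left)
    then show ?thesis
      using noncrossingD[OF nc, of u x w y] w by simp
  qed
  then have "\<forall>x\<in>set (u # as). \<forall>y\<in>set (bs @ [v]). E x y \<longrightarrow> x = u \<and> y = v"
    using w(3) by auto
  with w(1) show thesis by (rule that)
next
  case False
  with ne obtain w bs where "ys = [] @ w # bs" "\<forall>y\<in>set bs. \<not> E u y"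
    by (cases ys) auto
  then show thesis by (intro that[of "[]" w bs]) auto
qed

end

section \<open>Defective colourings of covers\<close>

text \<open>\<open>avoid\<close> condenses matchings and lists of size two: a colour conflicts with
  at most one colour of another list.\<close>

locale outerplanar_like_cover = outerplanar_like E
  for E :: "'a \<Rightarrow> 'a \<Rightarrow> bool" +
  fixes V :: "'a set" and L :: "'a \<Rightarrow> 'c set" and C :: "'c \<Rightarrow> 'c \<Rightarrow> bool"
  assumes fin: "finite V"
    and conflict_sym: "C x y \<Longrightarrow> C y x"
    and conflict_adj: "\<lbrakk>u \<in> V; v \<in> V; x \<in> L u; y \<in> L v; C x y\<rbrakk> \<Longrightarrow> E u v"
    and list_nonempty: "v \<in> V \<Longrightarrow> L v \<noteq> {}"
    and avoid: "\<lbrakk>u \<in> V; v \<in> V; u \<noteq> v; x \<in> L u\<rbrakk> \<Longrightarrow> \<exists>y\<in>L v. \<not> C x y"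
begin

definition conflicts :: "('a \<Rightarrow> 'c) \<Rightarrow> 'a set \<Rightarrow> 'a \<Rightarrow> 'a set" where
  "conflicts \<phi> X v = {y \<in> X. C (\<phi> v) (\<phi> y)}"

text \<open>The apex \<open>w\<close> avoids the colour of \<open>t\<close>, then it is the unprotected end of both smaller pieces,
  which costs it one conflict in each, besides the possible one with the other end.\<close>
lemma coloring_between:
  assumes "noncrossing (u # ys @ [v])" "distinct (u # ys @ [v])" "set (u # ys @ [v]) \<subseteq> V"
    and "cu \<in> L u" "cv \<in> L v" "t \<in> {u, v}"
  shows "\<exists>\<phi>. \<phi> u = cu \<and> \<phi> v = cv \<and> (\<forall>y\<in>set ys. \<phi> y \<in> L y \<and> card (conflicts \<phi> (set (u # ys @ [v])) y) \<le> 3) \<and>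
     (\<forall>s\<in>{u, v}. card (conflicts \<phi> (set ys) s) \<le> 1) \<and> conflicts \<phi> (set ys) t = {}"
  using assms
proof (induction "length ys" arbitrary: u ys v cu cv t rule: less_induct)
  case less
  note nc = less.prems(1) and dist = less.prems(2) and V = less.prems(3)
    and c = less.prems(4,5) and t = less.prems(6)
  show ?case
  proof (cases "ys = []")
    case True
    then show ?thesis using dist by (intro exI[of _ "\<lambda>x. if x = u then cu else cv"]) (auto simp: conflicts_def)
  next
    case False
    obtain as w bs where ys: "ys = as @ w # bs"
      and "\<forall>x\<in>set (u # as). \<forall>y\<in>set (bs @ [v]). E x y \<longrightarrow> x = u \<and> y = v"
      using noncrossing_apex[OF nc False] .
    then have sep: "x \<in> set (u # as) \<Longrightarrow> y \<in> set (bs @ [v]) \<Longrightarrow> E x y \<Longrightarrow> x = u \<and> y = v" for x y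
      by blast
    have mem: "u \<in> V" "v \<in> V" "w \<in> V" "set as \<subseteq> V" "set bs \<subseteq> V" using V by (auto simp: ys)
    have dist': "distinct (u # as @ w # bs @ [v])" using dist by (simp add: ys)
    \<comment> \<open>The colour of the protected end, the one colour that \<open>w\<close> can be
      made to avoid.\<close>
    define ct where "ct = (if t = u then cu else cv)"
    have "ct \<in> L t" "t \<in> V" "t \<noteq> w" using c t mem dist' by (auto simp: ct_def)
    then obtain cw where cw: "cw \<in> L w" "\<not> C ct cw"
      using avoid mem by blast
    have left_nc: "noncrossing (u # as @ [w])"
    proof (rule noncrossing_subseq[OF nc])
      have "subseq ((u # as @ [w]) @ []) ((u # as @ [w]) @ bs @ [v])"
        by (rule list_emb_append_mono) simp_all
      then show "subseq (u # as @ [w]) (u # ys @ [v])" by (simp add: ys)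
    qed
    have right_nc: "noncrossing (w # bs @ [v])"
    proof (rule noncrossing_subseq[OF nc])
      have "subseq ([] @ w # bs @ [v]) ((u # as) @ w # bs @ [v])"
        by (rule list_emb_append_mono) simp_all
      then show "subseq (w # bs @ [v]) (u # ys @ [v])" by (simp add: ys)
    qed
    \<comment> \<open>Each piece protects its outer end, so at \<open>u\<close> and \<open>v\<close>
      only \<open>w\<close> can cause a conflict from inside.\<close>
    obtain \<phi>1 where \<phi>1: "\<phi>1 u = cu" "\<phi>1 w = cw"
      "\<forall>y\<in>set as. \<phi>1 y \<in> L y \<and> card (conflicts \<phi>1 (set (u # as @ [w])) y) \<le> 3"
      "card (conflicts \<phi>1 (set as) w) \<le> 1" "conflicts \<phi>1 (set as) u = {}"
      using less.hyps[of as u w cu cw u] left_nc dist' mem c cw by (auto simp: ys)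
    obtain \<phi>2 where \<phi>2: "\<phi>2 w = cw" "\<phi>2 v = cv"
      "\<forall>y\<in>set bs. \<phi>2 y \<in> L y \<and> card (conflicts \<phi>2 (set (w # bs @ [v])) y) \<le> 3"
      "card (conflicts \<phi>2 (set bs) w) \<le> 1" "conflicts \<phi>2 (set bs) v = {}"
      using less.hyps[of bs w v cw cv v] right_nc dist' mem c cw by (auto simp: ys)
    define \<phi> where "\<phi> x = (if x \<in> set (u # as @ [w]) then \<phi>1 x else \<phi>2 x)" for x
    have eq1: "\<phi> x = \<phi>1 x" if "x \<in> set (u # as @ [w])" for x
      using that by (simp add: \<phi>_def)
    have eq2: "\<phi> x = \<phi>2 x" if "x \<in> set (w # bs @ [v])" for x
      using that dist' \<phi>1(2) \<phi>2(1) by (auto simp: \<phi>_def)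
    have ends: "\<phi> u = cu" "\<phi> v = cv" "\<phi> w = cw"
      using eq1 eq2 \<phi>1(1,2) \<phi>2(2) by simp_all
    have lists: "\<phi> y \<in> L y" if "y \<in> set (u # ys @ [v])" for y
      using that \<phi>1(3) \<phi>2(3) eq1[of y] eq2[of y] ends c cw by (auto simp: ys)
    have adj: "E x y" if "C (\<phi> x) (\<phi> y)" "x \<in> set (u # ys @ [v])" "y \<in> set (u # ys @ [v])" for x y
      using that lists conflict_adj V by blast
    have all: "set (u # ys @ [v]) = set (u # as @ [w]) \<union> set (bs @ [v])"
      "set (u # ys @ [v]) = set (w # bs @ [v]) \<union> set (u # as)" "set ys = insert w (set as \<union> set bs)"
      by (auto simp: ys)
    have diff: "u \<notin> set as" "v \<notin> set bs" "u \<noteq> v"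
      using dist' by auto
    have conf_adj: "E y z \<and> z \<in> X" if "z \<in> conflicts \<phi> X y" "X \<subseteq> set (u # ys @ [v])" "y \<in> set (u # ys @ [v])" for X y z
      using that adj unfolding conflicts_def by blast
    have ys_all: "set ys \<subseteq> set (u # ys @ [v])" "u \<in> set (u # ys @ [v])" "v \<in> set (u # ys @ [v])" by auto
    have conf1: "conflicts \<phi> X y = conflicts \<phi>1 X y" if "y \<in> set (u # as @ [w])" "X \<subseteq> set (u # as @ [w])" for X y
      using that eq1 by (auto simp: conflicts_def)
    have conf2: "conflicts \<phi> X y = conflicts \<phi>2 X y" if "y \<in> set (w # bs @ [v])" "X \<subseteq> set (w # bs @ [v])" for X y
      using that eq2 by (auto simp: conflicts_def)
    have as_left: "set as \<subseteq> set (u # as @ [w])" and bs_right: "set bs \<subseteq> set (w # bs @ [v])"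
      by auto
    have "card (conflicts \<phi> (set (u # ys @ [v])) y) \<le> 3" if y: "y \<in> set ys" for y
    proof -
      consider "y \<in> set as" | "y = w" | "y \<in> set bs" using y by (auto simp: ys)
      then show ?thesis
      proof cases
        case 1
        \<comment> \<open>Conflicting colours belong to adjacent vertices, so the separation at
          \<open>w\<close> confines the conflicts of an inner vertex to its own piece.\<close>
        have "z \<in> set (u # as @ [w])" if z: "z \<in> conflicts \<phi> (set (u # ys @ [v])) y" for z
        proof (rule ccontr)
          assume "z \<notin> set (u # as @ [w])"
          moreover have "E y z \<and> z \<in> set (u # ys @ [v])"
            using conf_adj[OF z] y by simp
          ultimately have "z \<in> set (bs @ [v])" "E y z"
            unfolding all(1) by blast+
          moreover have "y \<in> set (u # as)" using 1 by simp
          ultimately have "y = u" using sep by blast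
          then show False using 1 diff by simp
        qed
        then have "conflicts \<phi> (set (u # ys @ [v])) y \<subseteq> conflicts \<phi> (set (u # as @ [w])) y"
          by (auto simp: conflicts_def)
        then have "conflicts \<phi> (set (u # ys @ [v])) y \<subseteq> conflicts \<phi>1 (set (u # as @ [w])) y"
          using conf1[of y] 1 by simp
        moreover have "finite (conflicts \<phi>1 (set (u # as @ [w])) y)" by (simp add: conflicts_def)
        ultimately show ?thesis using \<phi>1(3) 1 by (meson card_mono order_trans)
      next
        case 3
        have "z \<in> set (w # bs @ [v])" if z: "z \<in> conflicts \<phi> (set (u # ys @ [v])) y" for z
        proof (rule ccontr)
          assume "z \<notin> set (w # bs @ [v])"
          moreover have "E y z \<and> z \<in> set (u # ys @ [v])"
            using conf_adj[OF z] y by simp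
          ultimately have "z \<in> set (u # as)" "E z y"
            unfolding all(2) using sym by blast+
          moreover have "y \<in> set (bs @ [v])" using 3 by simp
          ultimately have "y = v" using sep by blast
          then show False using 3 diff by simp
        qed
        then have "conflicts \<phi> (set (u # ys @ [v])) y \<subseteq> conflicts \<phi> (set (w # bs @ [v])) y"
          by (auto simp: conflicts_def)
        then have "conflicts \<phi> (set (u # ys @ [v])) y \<subseteq> conflicts \<phi>2 (set (w # bs @ [v])) y"
          using conf2[of y] 3 by simp
        moreover have "finite (conflicts \<phi>2 (set (w # bs @ [v])) y)" by (simp add: conflicts_def)
        ultimately show ?thesis using \<phi>2(3) 3 by (meson card_mono order_trans)
      next
        case 2
        obtain t' where t': "{u, v} = {t, t'}" using t by blast
        have "\<phi> t = ct" using ends t by (auto simp: ct_def)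
        then have "t \<notin> conflicts \<phi> (set (u # ys @ [v])) w"
          using cw ends conflict_sym by (auto simp: conflicts_def)
        moreover have "w \<notin> conflicts \<phi> (set (u # ys @ [v])) w"
          using adj[of w w] irrefl by (auto simp: conflicts_def)
        \<comment> \<open>The count behind the constant 3: the unprotected end \<open>t'\<close>,
          and at most one conflict from each piece.\<close>
        ultimately have "conflicts \<phi> (set (u # ys @ [v])) w \<subseteq> insert t' (conflicts \<phi> (set as) w \<union> conflicts \<phi> (set bs) w)"
          using t' by (auto simp: conflicts_def ys)
        then have "card (conflicts \<phi> (set (u # ys @ [v])) w) \<le> card (insert t' (conflicts \<phi> (set as) w \<union> conflicts \<phi> (set bs) w))"
          by (intro card_mono) (auto simp: conflicts_def)
        also have "\<dots> \<le> Suc (card (conflicts \<phi> (set as) w \<union> conflicts \<phi> (set bs) w))"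
          by (rule card_insert_le_m1) simp_all
        also have "\<dots> \<le> Suc (card (conflicts \<phi>1 (set as) w) + card (conflicts \<phi>2 (set bs) w))"
          using card_Un_le[of "conflicts \<phi>1 (set as) w" "conflicts \<phi>2 (set bs) w"]
            conf1[OF _ as_left, of w] conf2[OF _ bs_right, of w] by simp
        finally show ?thesis using 2 \<phi>1(4) \<phi>2(4) by simp
      qed
    qed
    moreover have u: "conflicts \<phi> (set ys) u \<subseteq> {x. x = w \<and> C cu cw}"
    proof
      fix z assume z: "z \<in> conflicts \<phi> (set ys) u"
      have Ez: "E u z" "z \<in> set ys"
        using conf_adj[OF z] ys_all by blast+
      have "z \<notin> set bs"
      proof
        assume "z \<in> set bs"
        moreover have "u \<in> set (u # as)" by simp
        ultimately have "z = v" using sep[of u z] Ez by (metis UnI1 set_append)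
        with \<open>z \<in> set bs\<close> diff show False by simp
      qed
      moreover have "z \<notin> set as"
        using z \<phi>1(5) conf1[OF _ as_left, of u] by (auto simp: conflicts_def)
      ultimately show "z \<in> {x. x = w \<and> C cu cw}"
        using z ends by (auto simp: conflicts_def ys)
    qed
    moreover have v: "conflicts \<phi> (set ys) v \<subseteq> {x. x = w \<and> C cv cw}"
    proof
      fix z assume z: "z \<in> conflicts \<phi> (set ys) v"
      have Ez: "E z v" "z \<in> set ys"
        using conf_adj[OF z] ys_all sym by blast+
      have "z \<notin> set as"
      proof
        assume "z \<in> set as"
        moreover have "v \<in> set (bs @ [v])" by simp
        ultimately have "z = u" using sep[of z v] Ez by (metis list.set_intros(2))
        with \<open>z \<in> set as\<close> diff show False by simp
      qed
      moreover have "z \<notin> set bs"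
        using z \<phi>2(5) conf2[OF _ bs_right, of v] by (auto simp: conflicts_def)
      ultimately show "z \<in> {x. x = w \<and> C cv cw}"
        using z ends by (auto simp: conflicts_def ys)
    qed
    moreover have "card (conflicts \<phi> (set ys) s) \<le> 1" if "s \<in> {u, v}" for s
    proof -
      have "conflicts \<phi> (set ys) s \<subseteq> {w}" using that u v by blast
      then show ?thesis using card_mono[of "{w}"] by fastforce
    qed
    moreover have "conflicts \<phi> (set ys) t = {}"
      using t u v cw(2) by (auto simp: ct_def split: if_splits)
    ultimately show ?thesis using ends lists by (intro exI[of _ \<phi>]) auto
  qed
qed

text \<open>\<open>coloring_between\<close> leaves the pair of ends open, so the colour of the last
  vertex is chosen to avoid that of the first. It also needs two ends, hence the separate case of
  one vertex.\<close>

lemma exists_coloring: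
  assumes nc: "noncrossing xs" "distinct xs" "set xs = V"
  shows "\<exists>\<phi>. \<forall>v\<in>V. \<phi> v \<in> L v \<and> card (conflicts \<phi> V v) \<le> 3"
proof -
  consider "V = {}" | u where "V = {u}" | u ys v where "xs = u # ys @ [v]"
  proof (cases xs rule: rev_cases)
    case (snoc zs v)
    then show ?thesis using that nc by (cases zs) auto
  qed (use that nc in auto)
  then show ?thesis
  proof cases
    case 2
    then obtain c where "c \<in> L u" using list_nonempty by blast
    moreover have "card (conflicts (\<lambda>x. c) V u) \<le> card {u}"
      using 2 by (intro card_mono) (auto simp: conflicts_def)
    ultimately show ?thesis using 2 by (intro exI[of _ "\<lambda>x. c"]) auto
  next
    case 3
    have uv: "u \<in> V" "v \<in> V" "u \<noteq> v" using nc 3 by auto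
    then obtain cu where cu: "cu \<in> L u" using list_nonempty by blast
    then obtain cv where cv: "cv \<in> L v" "\<not> C cu cv" using avoid uv by blast
    obtain \<phi> where \<phi>: "\<phi> u = cu" "\<phi> v = cv"
      "\<forall>y\<in>set ys. \<phi> y \<in> L y \<and> card (conflicts \<phi> V y) \<le> 3"
      "\<forall>s\<in>{u, v}. card (conflicts \<phi> (set ys) s) \<le> 1"
      using coloring_between[of u ys v cu cv u] nc cu cv unfolding 3 by auto
    have "card (conflicts \<phi> V s) \<le> 3" if s: "s \<in> {u, v}" for s
    proof -
      \<comment> \<open>Admitting \<open>s\<close> itself saves an argument; the resulting bound 2
        is within 3.\<close>
      have "conflicts \<phi> V s \<subseteq> insert s (conflicts \<phi> (set ys) s)"
        using s nc 3 \<phi>(1,2) cv conflict_sym by (auto simp: conflicts_def)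
      then have "card (conflicts \<phi> V s) \<le> card (insert s (conflicts \<phi> (set ys) s))"
        by (intro card_mono) (auto simp: conflicts_def)
      also have "\<dots> \<le> Suc (card (conflicts \<phi> (set ys) s))"
        by (rule card_insert_le_m1) simp_all
      finally show ?thesis using \<phi>(4) s by fastforce
    qed
    moreover have "\<phi> y \<in> L y" if "y \<in> V" for y
      using that \<phi> cu cv nc 3 by auto
    ultimately show ?thesis using \<phi> nc 3 by (intro exI[of _ \<phi>]) auto
  qed simp
qed

end

section \<open>From correspondence covers to the abstract colouring\<close>

context outerplane_graph begin

sublocale outerplanar_like "adj G"
proof
  show "adj G y x" if "adj G x y" for x y
    using that by (simp add: insert_commute)
  show "\<not> adj G x x" for x
    using simple by (auto simp: simple_graph_def)
qed (rule no_theta_subdivision no_K4_subdivision; assumption)+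

lemma defective_3_correspondable_2: "defective_correspondable TYPE('c) 3 2 G"
  unfolding defective_correspondable_def
proof (intro allI impI, elim conjE)
  fix L :: "'a \<Rightarrow> 'c set" and H :: "'c ugraph"
  assume cover: "correspondence_cover G L H" and fold: "fold_cover 2 G L"
  have H: "simple_graph H" and match: "\<And>u v. u \<in> verts G \<Longrightarrow> v \<in> verts G \<Longrightarrow>
      matching (edges (induced_subgraph H (L u \<union> L v)))"
    and empty: "\<And>u v. u \<in> verts G \<Longrightarrow> v \<in> verts G \<Longrightarrow> \<not> adj G u v \<Longrightarrow>
      edges (induced_subgraph H (L u \<union> L v)) = {}"
    using cover by (auto simp: correspondence_cover_def)
  interpret outerplanar_like_cover "adj G" "verts G" L "adj H"
  proof
    show "finite (verts G)" using simple by (simp add: simple_graph_def)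
    show "adj H y x" if "adj H x y" for x y
      using that by (simp add: insert_commute)
    show "adj G u v" if "u \<in> verts G" "v \<in> verts G" "x \<in> L u" "y \<in> L v" "adj H x y" for u v x y
    proof (rule ccontr)
      assume "\<not> adj G u v"
      then have "edges (induced_subgraph H (L u \<union> L v)) = {}" using empty that by blast
      moreover have "{x, y} \<in> edges (induced_subgraph H (L u \<union> L v))"
        using that by (simp add: induced_subgraph_def)
      ultimately show False by blast
    qed
    show "L v \<noteq> {}" if "v \<in> verts G" for v
      using fold that by (auto simp: fold_cover_def)
    show "\<exists>y\<in>L v. \<not> adj H x y" if uv: "u \<in> verts G" "v \<in> verts G" "u \<noteq> v" "x \<in> L u" for u v x
    proof (rule ccontr)
      assume "\<not> ?thesis"
      moreover have "2 \<le> card (L v)" using fold that by (auto simp: fold_cover_def)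
      \<comment> \<open>Two colours of one list adjacent to \<open>x\<close> give two edges sharing
        \<open>x\<close>, which a matching forbids.\<close>
      then obtain y z where "y \<in> L v" "z \<in> L v" "y \<noteq> z"
        by (metis card_le_Suc0_iff_eq card.infinite not_less_eq_eq numeral_2_eq_2 zero_le)
      ultimately have "{x, y} \<in> edges (induced_subgraph H (L u \<union> L v))"
        "{x, z} \<in> edges (induced_subgraph H (L u \<union> L v))" "{x, y} \<noteq> {x, z}"
        using uv by (auto simp: induced_subgraph_def doubleton_eq_iff)
      with match[OF uv(1,2)] show False
        unfolding matching_def by (metis disjnt_insert1 insertI1 pairwiseD)
    qed
  qed
  obtain xs where "distinct xs" "set xs = verts G" "noncrossing xs"
    using exists_noncrossing_list[OF fin] by blast
  then obtain \<phi> where \<phi>: "\<forall>v\<in>verts G. \<phi> v \<in> L v \<and> card (conflicts \<phi> (verts G) v) \<le> 3"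
    using exists_coloring by blast
  have "vertex_degree (induced_subgraph H (\<phi> ` verts G)) (\<phi> v) \<le> 3" if "v \<in> verts G" for v
  proof -
    let ?N = "{e \<in> edges (induced_subgraph H (\<phi> ` verts G)). \<phi> v \<in> e}"
    \<comment> \<open>Every edge at the colour of \<open>v\<close> comes from a conflicting vertex,
      so counting vertices bounds the degree in \<open>H\<close>.\<close>
    have "?N \<subseteq> (\<lambda>y. {\<phi> v, \<phi> y}) ` conflicts \<phi> (verts G) v"
    proof
      fix e assume e: "e \<in> ?N"
      then have "e \<in> edges H" "e \<subseteq> \<phi> ` verts G" "\<phi> v \<in> e"
        by (auto simp: induced_subgraph_def)
      moreover have "card e = 2" using H \<open>e \<in> edges H\<close> by (auto simp: simple_graph_def)
      then obtain c where "e = {\<phi> v, c}" using \<open>\<phi> v \<in> e\<close> by (auto simp: card_2_iff)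
      ultimately show "e \<in> (\<lambda>y. {\<phi> v, \<phi> y}) ` conflicts \<phi> (verts G) v"
        by (auto simp: conflicts_def)
    qed
    moreover have "finite (conflicts \<phi> (verts G) v)" using fin by (simp add: conflicts_def)
    ultimately have "card ?N \<le> card (conflicts \<phi> (verts G) v)" by (intro surj_card_le)
    then show ?thesis using \<phi> that by (fastforce simp: vertex_degree_def)
  qed
  then have "defective 3 G H \<phi>"
    by (auto simp: defective_def max_degree_at_most_def induced_subgraph_def)
  with \<phi> show "\<exists>\<phi>. cover_coloring G L \<phi> \<and> defective 3 G H \<phi>"
    by (auto simp: cover_coloring_def)
qed

end

lemma outerplanar_3_defective:
  assumes "simple_graph G" "outerplanar G"
  shows "defective_correspondable TYPE('c) 3 2 G"
  using assms outerplane_graph.defective_3_correspondable_2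
  unfolding outerplanar_def outerplane_graph_def by blast

section \<open>A graph needing three defects\<close>

definition parabola :: "nat \<Rightarrow> complex" where
  "parabola k = Complex (real k) ((real k)\<^sup>2)"

lemma inj_parabola: "inj parabola"
  by (rule injI) (simp add: parabola_def)

text \<open>The chord has slope \<open>a + b\<close>, so it is the graph of an affine function of
  the real part and intersections become polynomial identities.\<close>

lemma in_chord_iff:
  assumes "a \<le> b"
  shows "z \<in> closed_segment (parabola a) (parabola b) \<longleftrightarrow>
    real a \<le> Re z \<and> Re z \<le> real b \<and> Im z = (real a + real b) * Re z - real a * real b"
proof
  assume "z \<in> closed_segment (parabola a) (parabola b)"
  then obtain t where t: "0 \<le> t" "t \<le> 1" "z = (1 - t) *\<^sub>R parabola a + t *\<^sub>R parabola b"
    by (auto simp: in_segment)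
  have Re: "Re z = real a + t * (real b - real a)"
    and Im: "Im z = (1 - t) * (real a)\<^sup>2 + t * (real b)\<^sup>2"
    unfolding t(3) by (simp_all add: parabola_def algebra_simps)
  have "t * (real b - real a) \<le> real b - real a"
    using mult_right_mono[OF t(2), of "real b - real a"] assms by simp
  moreover have "0 \<le> t * (real b - real a)"
    using t assms by simp
  moreover have "Im z = (real a + real b) * Re z - real a * real b"
    unfolding Re Im by (simp add: algebra_simps power2_eq_square)
  ultimately show "real a \<le> Re z \<and> Re z \<le> real b \<and> Im z = (real a + real b) * Re z - real a * real b"
    unfolding Re by (intro conjI) linarith+
next
  assume z: "real a \<le> Re z \<and> Re z \<le> real b \<and> Im z = (real a + real b) * Re z - real a * real b"
  show "z \<in> closed_segment (parabola a) (parabola b)"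
  proof (cases "a = b")
    case True
    with z have Re: "Re z = real a" and "Im z = (real a + real a) * Re z - real a * real a"
      by simp_all
    then have "Im z = (real a)\<^sup>2" by (simp add: power2_eq_square algebra_simps)
    with Re have "z = parabola a" by (simp add: parabola_def complex_eq_iff)
    then show ?thesis by simp
  next
    case False
    then have pos: "0 < real b - real a" using assms by simp
    define t where "t = (Re z - real a) / (real b - real a)"
    have t: "0 \<le> t" "t \<le> 1" using z pos by (auto simp: t_def field_simps)
    have Re: "Re z = real a + t * (real b - real a)" using pos by (simp add: t_def)
    have "z = (1 - t) *\<^sub>R parabola a + t *\<^sub>R parabola b"
      using z by (simp add: complex_eq_iff parabola_def Re algebra_simps power2_eq_square)
    then show ?thesis using t by (auto simp: in_segment)
  qed
qed

lemma chord_through_parabola: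
  assumes "a \<le> b" "parabola v \<in> closed_segment (parabola a) (parabola b)"
  shows "v = a \<or> v = b"
proof -
  have "Im (parabola v) = (real a + real b) * Re (parabola v) - real a * real b"
    using assms by (simp add: in_chord_iff)
  then have "(real v)\<^sup>2 = (real a + real b) * real v - real a * real b"
    by (simp add: parabola_def)
  then have "(real v - real a) * (real v - real b) = 0"
    by (simp add: algebra_simps power2_eq_square)
  then show ?thesis by simp
qed

text \<open>At real part \<open>x\<close> the chord lies \<open>(x - a) * (b - x)\<close> above the
  parabola. For nested distinct intervals the outer chord is strictly higher over the interior of
  the inner interval, so the chords meet only at a common end. Other positions follow by exchanging
  the chords.\<close>

lemma chords_Int:
  assumes ab: "a < b" and cd: "c < d" and ne: "(a, b) \<noteq> (c, d)" and ord: "b \<le> c \<or> (a \<le> c \<and> d \<le> b)"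
    and z: "z \<in> closed_segment (parabola a) (parabola b)" "z \<in> closed_segment (parabola c) (parabola d)"
  shows "z \<in> parabola ` ({a, b} \<inter> {c, d})"
proof -
  have A: "real a \<le> Re z" "Re z \<le> real b" "Im z = (real a + real b) * Re z - real a * real b"
    using z(1) ab by (simp_all add: in_chord_iff)
  have C: "real c \<le> Re z" "Re z \<le> real d" "Im z = (real c + real d) * Re z - real c * real d"
    using z(2) cd by (simp_all add: in_chord_iff)
  have on: "z = parabola v" if "v \<in> {a, b}" "Re z = real v" for v
    using that A(3) by (auto simp: complex_eq_iff parabola_def power2_eq_square algebra_simps)
  show ?thesis
  proof (cases "b \<le> c")
    case True
    then have "b = c" "Re z = real b" using A(2) C(1) by auto
    then show ?thesis using on[of b] by auto
  next
    case False
    with ord have nest: "a \<le> c" "d \<le> b" by auto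
    have prod: "(Re z - real a) * (real b - Re z) = (Re z - real c) * (real d - Re z)"
      using A(3) C(3) by (simp add: algebra_simps)
    have c0: "0 \<le> Re z - real c" and d0: "0 \<le> real d - Re z" using C by auto
    have ac: "Re z - real c \<le> Re z - real a" and bd: "real d - Re z \<le> real b - Re z" using nest by auto
    have "Re z = real c \<or> Re z = real d"
    proof (rule ccontr)
      assume "\<not> ?thesis"
      then have pos: "0 < Re z - real c" "0 < real d - Re z" using c0 d0 by auto
      show False
      proof (cases "a = c")
        case True
        then have "d < b" using ne nest by auto
        then show False using prod True pos by auto
      next
        case False
        then have "(Re z - real c) * (real d - Re z) < (Re z - real a) * (real b - Re z)"
          using pos bd nest by (intro mult_less_le_imp_less) auto
        then show False using prod by simp
      qed
    qed
    then show ?thesis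
    proof
      assume Re: "Re z = real c"
      then have "(real c - real a) * (real b - real c) = 0" using prod by simp
      then have "c \<in> {a, b}" by auto
      then show ?thesis using on[of c] Re by auto
    next
      assume Re: "Re z = real d"
      then have "(real d - real a) * (real b - real d) = 0" using prod by simp
      then have "d \<in> {a, b}" by auto
      then show ?thesis using on[of d] Re by auto
    qed
  qed
qed

text \<open>Drawing vertex \<open>k\<close> at \<open>(k, k\<^sup>2)\<close> with straight edges puts the whole drawing above the parabola
  and every vertex on it.\<close>
lemma outerplanar_of_noncrossing:
  fixes G :: "nat ugraph"
  assumes simple: "simple_graph G"
    and nc: "\<And>a b c d. a < c \<Longrightarrow> c < b \<Longrightarrow> b < d \<Longrightarrow> {a, b} \<in> edges G \<Longrightarrow> {c, d} \<in> edges G \<Longrightarrow> False"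
  shows "outerplanar G"
proof -
  define \<gamma> where "\<gamma> e = linepath (parabola (Min e)) (parabola (Max e))" for e
  have edge: "\<exists>a b. a < b \<and> e = {a, b} \<and> \<gamma> e = linepath (parabola a) (parabola b)" if "e \<in> edges G" for e
  proof -
    have "card e = 2" using simple that by (simp add: simple_graph_def)
    then obtain a b where "e = {a, b}" "a < b"
      by (metis card_2_iff insert_commute linorder_neqE_nat)
    then show ?thesis by (intro exI[of _ a] exI[of _ b]) (simp add: \<gamma>_def)
  qed
  have image: "path_image (\<gamma> {a, b}) = closed_segment (parabola a) (parabola b)" if "a < b" for a b
    using that by (simp add: \<gamma>_def)
  have inj: "parabola x = parabola y \<longleftrightarrow> x = y" for x y
    using inj_parabola by (auto dest: injD)
  have emb: "plane_embedding G parabola \<gamma>"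
    unfolding plane_embedding_def
  proof (intro conjI ballI impI)
    show "inj_on parabola (verts G)" using inj_parabola by (rule inj_on_subset) simp
    fix e assume e: "e \<in> edges G"
    then obtain a b where ab: "a < b" "e = {a, b}" "\<gamma> e = linepath (parabola a) (parabola b)"
      using edge by blast
    show "arc (\<gamma> e)" "{pathstart (\<gamma> e), pathfinish (\<gamma> e)} = parabola ` e"
      using ab by (simp_all add: inj arc_linepath)
    have "e \<subseteq> verts G" using simple e by (simp add: simple_graph_def)
    then show "path_image (\<gamma> e) \<inter> parabola ` verts G = parabola ` e"
      using ab chord_through_parabola[of a b] by auto
    fix f assume f: "f \<in> edges G" "e \<noteq> f"
    then obtain c d where cd: "c < d" "f = {c, d}" "\<gamma> f = linepath (parabola c) (parabola d)"
      using edge by blast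
    have ne: "(a, b) \<noteq> (c, d)" using f ab cd by auto
    have "\<not> (a < c \<and> c < b \<and> b < d)" "\<not> (c < a \<and> a < d \<and> d < b)"
      using nc[of a c b d] nc[of c a d b] e f ab cd by auto
    then have "b \<le> c \<or> (a \<le> c \<and> d \<le> b) \<or> d \<le> a \<or> (c \<le> a \<and> b \<le> d)"
      using ab(1) cd(1) by linarith
    then have "path_image (\<gamma> e) \<inter> path_image (\<gamma> f) \<subseteq> parabola ` (e \<inter> f)"
      using chords_Int[of a b c d] chords_Int[of c d a b] ab cd ne by (auto simp: Int_commute)
    moreover have "parabola ` (e \<inter> f) \<subseteq> path_image (\<gamma> e) \<inter> path_image (\<gamma> f)"
      using ab cd by auto
    ultimately show "path_image (\<gamma> e) \<inter> path_image (\<gamma> f) = parabola ` (e \<inter> f)" by blast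
  qed
  let ?D = "drawing G parabola \<gamma>" and ?above = "{z. (Re z)\<^sup>2 \<le> Im z}"
  have "?D \<subseteq> ?above"
  proof
    fix z assume "z \<in> ?D"
    then consider v where "z = parabola v" | e where "e \<in> edges G" "z \<in> path_image (\<gamma> e)"
      by (auto simp: drawing_def)
    then show "z \<in> ?above"
    proof cases
      case 2
      then obtain a b where ab: "a < b" "e = {a, b}"
        using edge by blast
      then have "z \<in> closed_segment (parabola a) (parabola b)"
        using 2 image by simp
      then have z: "real a \<le> Re z" "Re z \<le> real b" "Im z = (real a + real b) * Re z - real a * real b"
        using ab(1) by (simp_all add: in_chord_iff)
      then have "0 \<le> (Re z - real a) * (real b - Re z)" by simp
      then show ?thesis using z(3) by (simp add: algebra_simps power2_eq_square)
    qed (simp add: parabola_def)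
  qed
  have conv: "convex ?above"
  proof -
    have "convex_on UNIV (\<lambda>x::real. x\<^sup>2)" by (rule convex_power2)
    then have *: "((1 - t) * x + t * y)\<^sup>2 \<le> (1 - t) * x\<^sup>2 + t * y\<^sup>2" if "0 \<le> t" "t \<le> 1" for t x y :: real
      using that by (auto simp: convex_on_def dest!: spec[of _ "1 - t"])
    show ?thesis
      unfolding convex_alt
    proof (intro ballI allI impI)
      fix x y :: complex and u :: real
      assume xy: "x \<in> ?above" "y \<in> ?above" and u: "0 \<le> u \<and> u \<le> 1"
      have "((1 - u) * Re x + u * Re y)\<^sup>2 \<le> (1 - u) * (Re x)\<^sup>2 + u * (Re y)\<^sup>2"
        using * u by blast
      also have "\<dots> \<le> (1 - u) * Im x + u * Im y"
        using xy u by (intro add_mono mult_left_mono) auto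
      finally show "(1 - u) *\<^sub>R x + u *\<^sub>R y \<in> ?above" by simp
    qed
  qed
  \<comment> \<open>The complement of a convex set is outside it, and a subset has a larger outside.
    Points just below a vertex then witness that it is on the frontier.\<close>
  have below: "- ?above \<subseteq> outside ?D"
    using outside_mono[OF \<open>?D \<subseteq> ?above\<close>] outside_convex[OF conv] by simp
  have "parabola v \<in> frontier (outside ?D)" if v: "v \<in> verts G" for v
  proof -
    have "parabola v \<in> closure (outside ?D)"
      unfolding closure_approachable
    proof (intro allI impI)
      fix \<epsilon> :: real assume \<epsilon>: "0 < \<epsilon>"
      let ?y = "Complex (real v) ((real v)\<^sup>2 - \<epsilon> / 2)"
      have "?y \<in> outside ?D" using below \<epsilon> by auto
      moreover have "dist ?y (parabola v) < \<epsilon>"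
        using \<epsilon> by (simp add: parabola_def dist_norm complex_diff cmod_def)
      ultimately show "\<exists>y\<in>outside ?D. dist y (parabola v) < \<epsilon>" by blast
    qed
    moreover have "parabola v \<in> ?D" using v by (simp add: drawing_def)
    then have "parabola v \<notin> interior (outside ?D)"
      using outside_no_overlap[of ?D] interior_subset by blast
    ultimately show ?thesis by (simp add: frontier_def)
  qed
  with emb show ?thesis unfolding outerplanar_def by blast
qed

section \<open>The gadget and its twisted cover\<close>

text \<open>A hub \<open>0\<close> and three blocks \<open>{5t+1, \<dots>, 5t+5}\<close>, each a path on the residues \<open>1, 2, 4, 0\<close> modulo 5
  joined to the hub, with a further vertex of residue \<open>3\<close> on its middle edge.\<close>
definition gadget_arc :: "nat \<Rightarrow> nat \<Rightarrow> bool" where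
  "gadget_arc x y \<longleftrightarrow> x < y \<and> y < 16 \<and>
     (x = 0 \<and> y mod 5 \<noteq> 3 \<or> 0 < x \<and> x mod 5 \<noteq> 0 \<and> y = x + 1 \<or> x mod 5 = 2 \<and> y = x + 2)"

definition gadget :: "nat ugraph" where
  "gadget = ({..<16}, {{x, y} |x y. gadget_arc x y})"

text \<open>Vertex \<open>k\<close> has the colours \<open>2k\<close> and \<open>2k+1\<close>. Equal parities conflict, except on the twisted edges
  whose smaller end has residue \<open>3\<close>, where different parities do.\<close>
definition gadget_conflict :: "nat \<Rightarrow> nat \<Rightarrow> bool" where
  "gadget_conflict p q \<longleftrightarrow> gadget_arc (p div 2) (q div 2) \<and> (p mod 2 = q mod 2 \<longleftrightarrow> (p div 2) mod 5 \<noteq> 3)"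

definition gadget_cover :: "nat ugraph" where
  "gadget_cover = ({..<32}, {{p, q} |p q. gadget_conflict p q})"

definition gadget_lists :: "nat \<Rightarrow> nat set" where
  "gadget_lists k = {2 * k, 2 * k + 1}"

lemma gadget_arc_less: "gadget_arc x y \<Longrightarrow> x < y \<and> y < 16"
  by (simp add: gadget_arc_def)

lemma gadget_edge_iff: "{x, y} \<in> edges gadget \<longleftrightarrow> gadget_arc x y \<or> gadget_arc y x"
  by (auto simp: gadget_def doubleton_eq_iff)

lemma in_gadget_lists_iff: "p \<in> gadget_lists k \<longleftrightarrow> p div 2 = k"
  by (auto simp: gadget_lists_def)

lemma simple_gadget: "simple_graph gadget"
  by (auto simp: simple_graph_def gadget_def dest!: gadget_arc_less)

text \<open>The numbering is itself a noncrossing order. An arc away from the hub with a vertex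
  strictly between its ends goes from a residue 2 to \<open>c + 2\<close>, and the vertex between
  has only these two ends as neighbours.\<close>

lemma outerplanar_gadget: "outerplanar gadget"
proof (rule outerplanar_of_noncrossing[OF simple_gadget])
  fix a b c d :: nat
  assume less: "a < c" "c < b" "b < d" and "{a, b} \<in> edges gadget" "{c, d} \<in> edges gadget"
  then have arcs: "gadget_arc a b" "gadget_arc c d"
    by (auto simp: gadget_edge_iff dest: gadget_arc_less)
  then have c: "c mod 5 = 2" "b = c + 1"
    using less unfolding gadget_arc_def by linarith+
  then have b: "b mod 5 = 3" by (simp add: mod_Suc)
  have "a mod 5 = 2" "c = a + 1"
    using arcs(1) less c(2) b unfolding gadget_arc_def by linarith+
  then show False using c(1) by (simp add: mod_Suc)
qed

lemma gadget_cover_edge: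
  assumes "e \<in> edges (induced_subgraph gadget_cover (gadget_lists u \<union> gadget_lists v))"
  obtains p q where "e = {p, q}" "gadget_conflict p q" "p div 2 < q div 2" "{p div 2, q div 2} = {u, v}"
proof -
  obtain p q where pq: "e = {p, q}" "gadget_conflict p q" "{p, q} \<subseteq> gadget_lists u \<union> gadget_lists v"
    using assms by (auto simp: induced_subgraph_def gadget_cover_def)
  then have "p div 2 < q div 2" by (auto simp: gadget_conflict_def dest: gadget_arc_less)
  moreover have "p div 2 \<in> {u, v}" "q div 2 \<in> {u, v}" using pq(3) by (auto simp: in_gadget_lists_iff)
  ultimately have "{p div 2, q div 2} = {u, v}" by auto
  with pq \<open>p div 2 < q div 2\<close> that show thesis by blast
qed

lemma two_valued:
  fixes x y x' y' :: nat
  assumes "x \<in> {0, 1}" "y \<in> {0, 1}" "x' \<in> {0, 1}" "y' \<in> {0, 1}" "(x = y) = (x' = y')"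
  shows "(x = x') = (y = y')"
  using assms by auto

text \<open>Both edges are read from the smaller to the larger vertex. Between two fixed vertices a
  conflict is either always equality or always inequality of parities, so each end determines the
  other.\<close>

lemma gadget_cover_matching:
  "matching (edges (induced_subgraph gadget_cover (gadget_lists u \<union> gadget_lists v)))"
  unfolding matching_def
proof (rule pairwiseI, rule ccontr)
  fix e f
  assume e: "e \<in> edges (induced_subgraph gadget_cover (gadget_lists u \<union> gadget_lists v))"
    and f: "f \<in> edges (induced_subgraph gadget_cover (gadget_lists u \<union> gadget_lists v))"
    and "e \<noteq> f" "\<not> disjnt e f"
  obtain p q where pq: "e = {p, q}" "gadget_conflict p q" "p div 2 < q div 2" "{p div 2, q div 2} = {u, v}"
    using gadget_cover_edge[OF e] .
  obtain p' q' where pq': "f = {p', q'}" "gadget_conflict p' q'" "p' div 2 < q' div 2" "{p' div 2, q' div 2} = {u, v}"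
    using gadget_cover_edge[OF f] .
  have div: "p div 2 = p' div 2" "q div 2 = q' div 2"
    using pq(3,4) pq'(3,4) by (auto simp: doubleton_eq_iff)
  then have "p \<noteq> q'" "q \<noteq> p'" using pq(3) by auto
  then have "p = p' \<or> q = q'"
    using \<open>\<not> disjnt e f\<close> unfolding pq(1) pq'(1) by (auto simp: disjnt_def)
  moreover have "p mod 2 = p' mod 2 \<longleftrightarrow> q mod 2 = q' mod 2"
  proof (rule two_valued)
    show "(p mod 2 = q mod 2) = (p' mod 2 = q' mod 2)"
      using pq(2) pq'(2) div by (simp add: gadget_conflict_def)
  qed auto
  ultimately have "p mod 2 = p' mod 2 \<and> q mod 2 = q' mod 2" by blast
  with div have "p = p'" "q = q'" using mult_div_mod_eq[of 2] by metis+
  with \<open>e \<noteq> f\<close> show False unfolding pq(1) pq'(1) by simp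
qed

lemma gadget_correspondence_cover: "correspondence_cover gadget gadget_lists gadget_cover"
  unfolding correspondence_cover_def
proof (intro conjI ballI impI)
  have "p < 32 \<and> q < 32 \<and> p \<noteq> q" if "gadget_conflict p q" for p q
    using that by (auto simp: gadget_conflict_def dest!: gadget_arc_less)
  then show simple: "simple_graph gadget_cover"
    by (auto simp: simple_graph_def gadget_cover_def card_insert_if)
  show "disjoint_family_on gadget_lists (verts gadget)"
    by (auto simp: disjoint_family_on_def in_gadget_lists_iff)
  show "(\<Union>v\<in>verts gadget. gadget_lists v) = verts gadget_cover"
    by (auto simp: gadget_def gadget_cover_def in_gadget_lists_iff)
  fix v assume v: "v \<in> verts gadget"
  have "edges (induced_subgraph gadget_cover (gadget_lists v)) = {}"
  proof (rule equals0I)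
    fix e assume "e \<in> edges (induced_subgraph gadget_cover (gadget_lists v))"
    then have "e \<in> edges (induced_subgraph gadget_cover (gadget_lists v \<union> gadget_lists v))" by simp
    then obtain p q where "p div 2 < q div 2" "{p div 2, q div 2} = {v, v}"
      using gadget_cover_edge by metis
    then show False by auto
  qed
  then show "independent_set gadget_cover (gadget_lists v)"
    using v by (auto simp: independent_set_def gadget_def gadget_cover_def gadget_lists_def)
  fix u assume "u \<in> verts gadget"
  show "matching (edges (induced_subgraph gadget_cover (gadget_lists v \<union> gadget_lists u)))"
    by (rule gadget_cover_matching)
  assume nonadj: "{v, u} \<notin> edges gadget"
  show "edges (induced_subgraph gadget_cover (gadget_lists v \<union> gadget_lists u)) = {}"
  proof (rule equals0I)
    fix e assume "e \<in> edges (induced_subgraph gadget_cover (gadget_lists v \<union> gadget_lists u))"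
    then obtain p q where pq: "gadget_conflict p q" "{p div 2, q div 2} = {v, u}"
      using gadget_cover_edge by metis
    from pq(1) have "{p div 2, q div 2} \<in> edges gadget" by (simp add: gadget_conflict_def gadget_edge_iff)
    then show False using nonadj pq(2) by simp
  qed
qed

lemma gadget_not_2_defective:
  assumes col: "cover_coloring gadget gadget_lists \<phi>" and defect: "defective 2 gadget gadget_cover \<phi>"
  shows False
proof -
  let ?I = "induced_subgraph gadget_cover (\<phi> ` verts gadget)"
  define s where "s v = \<phi> v mod 2" for v
  have div: "\<phi> v div 2 = v" if "v < 16" for v
    using col that by (auto simp: cover_coloring_def gadget_def in_gadget_lists_iff)
  have s: "s v = 0 \<or> s v = 1" for v by (auto simp: s_def)
  \<comment> \<open>\<open>div\<close> makes colours of distinct vertices distinct, so three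
    conflicting vertices yield three edges at one colour.\<close>
  have too_many: False
    if "v < 16" and W: "\<forall>w\<in>W. w < 16 \<and> {\<phi> v, \<phi> w} \<in> edges gadget_cover" "card W = 3" for v W
  proof -
    let ?N = "{e \<in> edges ?I. \<phi> v \<in> e}"
    have "inj_on (\<lambda>w. {\<phi> v, \<phi> w}) W"
    proof (rule inj_onI)
      fix x y assume "x \<in> W" "y \<in> W" "{\<phi> v, \<phi> x} = {\<phi> v, \<phi> y}"
      then have "\<phi> x = \<phi> y" by (auto simp: doubleton_eq_iff)
      then show "x = y" using div W \<open>x \<in> W\<close> \<open>y \<in> W\<close> by metis
    qed
    moreover have "(\<lambda>w. {\<phi> v, \<phi> w}) ` W \<subseteq> ?N"
      using W that(1) by (auto simp: induced_subgraph_def gadget_def)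
    moreover have "finite ?N"
    proof (rule finite_subset)
      show "?N \<subseteq> Pow (\<phi> ` verts gadget)" by (auto simp: induced_subgraph_def)
    qed (simp add: gadget_def)
    ultimately have "3 \<le> card ?N" using card_inj_on_le[of "\<lambda>w. {\<phi> v, \<phi> w}" W ?N] W(2) by simp
    moreover have "\<phi> v \<in> verts ?I"
      using div[OF that(1)] that(1) by (auto simp: induced_subgraph_def gadget_def gadget_cover_def)
    then have "card ?N \<le> 2"
      using defect by (auto simp: defective_def max_degree_at_most_def vertex_degree_def)
    ultimately show False by simp
  qed
  have conflict: "{\<phi> x, \<phi> y} \<in> edges gadget_cover \<and> {\<phi> y, \<phi> x} \<in> edges gadget_cover"
    if "gadget_arc x y" "s x = s y \<longleftrightarrow> x mod 5 \<noteq> 3" for x y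
  proof -
    have "gadget_conflict (\<phi> x) (\<phi> y)"
      using that gadget_arc_less[OF that(1)] by (simp add: gadget_conflict_def div s_def)
    then show ?thesis by (auto simp: gadget_cover_def)
  qed
  \<comment> \<open>Every block supplies a conflict with the hub, so the three blocks together
    overload the hub itself.\<close>
  have hub: "\<exists>w. w \<in> {5 * t + 1..5 * t + 5} \<and> {\<phi> 0, \<phi> w} \<in> edges gadget_cover" if t: "t < 3" for t
  proof (rule ccontr)
    assume none: "\<not> ?thesis"
    define a b w c d where "a = 5 * t + 1" and "b = 5 * t + 2" and "w = 5 * t + 3" and "c = 5 * t + 4"
      and "d = 5 * t + 5"
    note defs = a_def b_def w_def c_def d_def
    have mods: "a mod 5 = 1" "b mod 5 = 2" "w mod 5 = 3" "c mod 5 = 4" "d mod 5 = 0"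
      unfolding defs by presburger+
    have arcs: "gadget_arc a b" "gadget_arc b w" "gadget_arc w c" "gadget_arc c d" "gadget_arc b c"
      using t mods by (simp_all add: gadget_arc_def defs)
    have "gadget_arc 0 x" if "x \<in> {a, b, c, d}" for x
      using that t mods by (auto simp: gadget_arc_def defs)
    then have "s x \<noteq> s 0" if "x \<in> {a, b, c, d}" for x
      using conflict[of 0 x] none that by (auto simp: defs)
    then have "s a \<noteq> s 0" "s b \<noteq> s 0" "s c \<noteq> s 0" "s d \<noteq> s 0"
      by simp_all
    then have eq: "s a = s b" "s b = s c" "s c = s d"
      using s by metis+
    have lt: "b < 16" "c < 16" "a < 16" "d < 16" "w < 16" using t by (simp_all add: defs)
    show False
    \<comment> \<open>The edge \<open>bw\<close> is straight and \<open>wc\<close> is twisted. As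
      \<open>b\<close> and \<open>c\<close> have equal parity, exactly one of these is a conflict,
      added to the two conflicts that both \<open>b\<close> and \<open>c\<close> already have on the
      path.\<close>
    proof (cases "s b = s w")
      case True
      then have "\<forall>x\<in>{a, c, w}. x < 16 \<and> {\<phi> b, \<phi> x} \<in> edges gadget_cover"
        using conflict[of a b] conflict[of b c] conflict[of b w] arcs eq mods lt by simp
      then show False using too_many[of b "{a, c, w}"] lt by (simp add: defs)
    next
      case False
      then have "\<forall>x\<in>{b, d, w}. x < 16 \<and> {\<phi> c, \<phi> x} \<in> edges gadget_cover"
        using conflict[of b c] conflict[of c d] conflict[of w c] arcs eq mods lt by simp
      then show False using too_many[of c "{b, d, w}"] lt by (simp add: defs)
    qed
  qed
  obtain x where x: "x \<in> {1..5}" "{\<phi> 0, \<phi> x} \<in> edges gadget_cover" using hub[of 0] by auto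
  obtain y where y: "y \<in> {6..10}" "{\<phi> 0, \<phi> y} \<in> edges gadget_cover" using hub[of 1] by auto
  obtain z where z: "z \<in> {11..15}" "{\<phi> 0, \<phi> z} \<in> edges gadget_cover" using hub[of 2] by auto
  have "card {x, y, z} = 3" using x(1) y(1) z(1) by simp
  moreover have "\<forall>w\<in>{x, y, z}. w < 16 \<and> {\<phi> 0, \<phi> w} \<in> edges gadget_cover" using x y z by auto
  ultimately show False using too_many[of 0 "{x, y, z}"] by simp
qed

lemma gadget_not_correspondable: "\<not> defective_correspondable TYPE(nat) 2 2 gadget"
proof
  assume "defective_correspondable TYPE(nat) 2 2 gadget"
  moreover have "fold_cover 2 gadget gadget_lists"
    by (simp add: fold_cover_def gadget_lists_def)
  ultimately obtain \<phi> where "cover_coloring gadget gadget_lists \<phi>" "defective 2 gadget gadget_cover \<phi>"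
    using gadget_correspondence_cover unfolding defective_correspondable_def by blast
  then show False by (rule gadget_not_2_defective)
qed

theorem theorem1p5:
  "(\<forall>G :: 'a ugraph. simple_graph G \<and> outerplanar G \<longrightarrow>
      defective_correspondable TYPE('c) 3 2 G) \<and>
   (\<exists>G :: nat ugraph. simple_graph G \<and> outerplanar G \<and>
      \<not> defective_correspondable TYPE(nat) 2 2 G)"
  using outerplanar_3_defective simple_gadget outerplanar_gadget gadget_not_correspondable
  by blast

end
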